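(* Let $\mathcal{F}=\{f_i\}_{i\in I}$ be a $J$-frame for a Krein space $\mathcal{H}$ with synthesis operator $T$ and $J$-frame operator $S=TT^+$. Given a Bessel family $\mathcal{G}=\{g_i\}_{i\in I}$ in $\mathcal{H}$ with synthesis operator $V$, $\mathcal{G}$ is a dual family for $\mathcal{F}$ if and only if $V=S^{-1}T+W$ where $W\in L(\ell_2(I),\mathcal{H})$ satisfies $N(T)^{[\perp]}\subseteq N(W)$.
   Context: A (complex) Krein space is a vector space $\mathcal{H}$ with a hermitian sesquilinear form $[\cdot,\cdot]$ admitting a fundamental decomposition $\mathcal{H}=\mathcal{H}_+\dotplus\mathcal{H}_-$, direct and $[\cdot,\cdot]$-orthogonal, with $(\mathcal{H}_+,[\cdot,\cdot])$ and $(\mathcal{H}_-,-[\cdot,\cdot])$ Hilbert spaces. Fix one; the associated Hilbert inner product is $\langle x,y\rangle=[x_+,y_+]-[x_-,y_-]$, with norm $\|\cdot\|$ (the topology does not depend on the decomposition). For a subspace $\mathcal{S}$ of a Krein space, $\mathcal{S}^{[\perp]}=\{x:[x,s]=0\ \forall s\in\mathcal{S}\}$. A subspace $\mathcal{S}$ is uniformly $J$-positive (resp. uniformly $J$-negative) if there is $\alpha>0$ with $[x,x]\ge\alpha\|x\|^2$ (resp. $-[x,x]\ge\alpha\|x\|^2$) for all $x\in\mathcal{S}$; it is maximal if it is maximal under inclusion among such subspaces. The adjoint $T^+$ of a bounded operator between Krein spaces is defined by $[Tx,y]=[x,T^+y]$. $L(\cdot,\cdot)$ denotes bounded linear operators,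 $N(\cdot)$ nullspaces. A Bessel family is $\mathcal{F}=\{f_i\}_{i\in I}\subset\mathcal{H}$ with $\sum_i|\langle f,f_i\rangle|^2\le\beta\|f\|^2$ for all $f\in\mathcal{H}$ and some $\beta>0$; its synthesis operator is the bounded operator $T:\ell_2(I)\to\mathcal{H}$, $Tx=\sum_{i\in I}x_if_i$. Put $I_+=\{i: [f_i,f_i]\ge0\}$, $I_-=\{i:[f_i,f_i]<0\}$; $P_\pm$ is the orthogonal projection of $\ell_2(I)$ onto $\ell_2(I_\pm)$ and $T_\pm=TP_\pm$. The Bessel family $\mathcal{F}$ is a $J$-frame for $\mathcal{H}$ if the range $R(T_+)$ is a maximal uniformly $J$-positive subspace and $R(T_-)$ is a maximal uniformly $J$-negative subspace of $\mathcal{H}$. Given a $J$-frame $\mathcal{F}$, $\ell_2(I)$ is the Krein space with $[x,y]_2=\sum_{i\in I_+}x_i\overline{y_i}-\sum_{i\in I_-}x_i\overline{y_i}$; $T^+$ and $N(T)^{[\perp]}$ are taken with respect to this form. The $J$-frame operator $S=TT^+$ is invertible. Convention: $\operatorname{sgn}(t)=1$ for $t\ge 0$ and $\operatorname{sgn}(t)=-1$ for $t<0$. A Bessel family $\mathcal{G}=\{g_i\}_{i\in I}$ is a dual family for the $J$-frame $\mathcal{F}$ if $\sigma_i:=\operatorname{sgn}[f_i,f_i]=\operatorname{sgn}[g_i,g_i]$ for every $i\in I$ and $f=\sum_{i\in I}\sigma_i[f,f_i]g_i=\sum_{i\in I}\sigma_i[f,g_i]f_i$ for every $f\in\mathcal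{H}$.
   Formalization: The formal theorem additionally assumes sgn[f_i,f_i] = sgn[g_i,g_i] for all i; without it the "if" direction fails, e.g. H = ℂ with [x,y] = -x ȳ, F = (1,1), G = (1,0), where V = S⁻¹T + W with a suitable W but the signs differ at i = 2. *)

theory Defs
  imports "HOL-Analysis.Analysis"
begin

section \<open>The Hilbert space of square-summable families\<close>

typedef 'i ell2 = "{x :: 'i \<Rightarrow> complex. (\<lambda>i. (cmod (x i))\<^sup>2) summable_on UNIV}"
  morphisms coord Abs_ell2
  by (rule exI[of _ "\<lambda>_. 0"]) simp

setup_lifting type_definition_ell2

lemma ell2_summable_add:
  fixes x y :: "'i \<Rightarrow> complex"
  assumes "(\<lambda>i. (cmod (x i))\<^sup>2) summable_on UNIV" and "(\<lambda>i. (cmod (y i))\<^sup>2) summable_on UNIV"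
  shows "(\<lambda>i. (cmod (x i + y i))\<^sup>2) summable_on UNIV"
proof (rule summable_on_comparison_test)
  show "(\<lambda>i. 2 * (cmod (x i))\<^sup>2 + 2 * (cmod (y i))\<^sup>2) summable_on UNIV"
    by (intro summable_on_add summable_on_cmult_right assms)
  fix i
  have "(cmod (x i + y i))\<^sup>2 \<le> (cmod (x i) + cmod (y i))\<^sup>2"
    by (intro power_mono norm_triangle_ineq) simp
  also have "\<dots> \<le> 2 * (cmod (x i))\<^sup>2 + 2 * (cmod (y i))\<^sup>2"
    using sum_squares_bound[of "cmod (x i)" "cmod (y i)"] by (simp add: power2_sum)
  finally show "(cmod (x i + y i))\<^sup>2 \<le> 2 * (cmod (x i))\<^sup>2 + 2 * (cmod (y i))\<^sup>2" .
qed simp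

lemma ell2_summable_scale:
  fixes x :: "'i \<Rightarrow> complex"
  assumes "(\<lambda>i. (cmod (x i))\<^sup>2) summable_on UNIV"
  shows "(\<lambda>i. (cmod (c * x i))\<^sup>2) summable_on UNIV"
  using summable_on_cmult_right[OF assms, of "(cmod c)\<^sup>2"]
  by (simp add: norm_mult power_mult_distrib)

lemma ell2_summable_mult:
  fixes x y :: "'i \<Rightarrow> complex"
  assumes "(\<lambda>i. (cmod (x i))\<^sup>2) summable_on UNIV" and "(\<lambda>i. (cmod (y i))\<^sup>2) summable_on UNIV"
  shows "(\<lambda>i. x i * cnj (y i)) summable_on UNIV"
proof (rule abs_summable_summable, rule summable_on_comparison_test)
  show "(\<lambda>i. (cmod (x i))\<^sup>2 + (cmod (y i))\<^sup>2) summable_on UNIV"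
    by (intro summable_on_add assms)
  show "cmod (x i * cnj (y i)) \<le> (cmod (x i))\<^sup>2 + (cmod (y i))\<^sup>2" for i
    using sum_squares_bound[of "cmod (x i)" "cmod (y i)"]
      mult_nonneg_nonneg[OF norm_ge_zero[of "x i"] norm_ge_zero[of "y i"]]
    unfolding norm_mult complex_mod_cnj by linarith
qed simp

instantiation ell2 :: (type) real_vector
begin

lift_definition zero_ell2 :: "'a ell2" is "\<lambda>_. 0" by simp

lift_definition uminus_ell2 :: "'a ell2 \<Rightarrow> 'a ell2" is "\<lambda>x i. - x i" by simp

lift_definition plus_ell2 :: "'a ell2 \<Rightarrow> 'a ell2 \<Rightarrow> 'a ell2" is "\<lambda>x y i. x i + y i"
  by (rule ell2_summable_add)

lift_definition minus_ell2 :: "'a ell2 \<Rightarrow> 'a ell2 \<Rightarrow> 'a ell2" is "\<lambda>x y i. x i - y i"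
  subgoal for x y using ell2_summable_add[of x "\<lambda>i. - y i"] by simp
  done

lift_definition scaleR_ell2 :: "real \<Rightarrow> 'a ell2 \<Rightarrow> 'a ell2" is "\<lambda>r x i. r *\<^sub>R x i"
  unfolding scaleR_conv_of_real by (rule ell2_summable_scale)

instance
  by standard (transfer; simp add: algebra_simps)+

end

instantiation ell2 :: (type) real_inner
begin

definition inner_ell2 :: "'a ell2 \<Rightarrow> 'a ell2 \<Rightarrow> real"
  where "inner_ell2 x y = Re (\<Sum>\<^sub>\<infinity>i. coord x i * cnj (coord y i))"

definition norm_ell2 :: "'a ell2 \<Rightarrow> real"
  where "norm_ell2 x = sqrt (inner x x)"

definition sgn_ell2 :: "'a ell2 \<Rightarrow> 'a ell2"
  where "sgn_ell2 x = x /\<^sub>R norm x"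

definition dist_ell2 :: "'a ell2 \<Rightarrow> 'a ell2 \<Rightarrow> real"
  where "dist_ell2 x y = norm (x - y)"

definition uniformity_ell2 :: "('a ell2 \<times> 'a ell2) filter"
  where "uniformity_ell2 = (INF e\<in>{0 <..}. principal {(x, y). dist x y < e})"

definition open_ell2 :: "'a ell2 set \<Rightarrow> bool"
  where "open_ell2 U \<longleftrightarrow> (\<forall>x\<in>U. \<forall>\<^sub>F (x', y) in uniformity. x' = x \<longrightarrow> y \<in> U)"

instance
proof
  fix x y z :: "'a ell2" and r :: real
  have summ: "(\<lambda>i. coord u i * cnj (coord v i)) summable_on UNIV" for u v :: "'a ell2"
    using coord[of u] coord[of v] by (intro ell2_summable_mult) auto
  have inner_Re: "u \<bullet> v = (\<Sum>\<^sub>\<infinity>i. Re (coord u i * cnj (coord v i)))" for u v :: "'a ell2"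
    unfolding inner_ell2_def by (rule infsum_Re[symmetric, OF summ])
  have summ_Re: "(\<lambda>i. Re (coord u i * cnj (coord v i))) summable_on UNIV" for u v :: "'a ell2"
    by (rule summable_on_Re[OF summ])
  show "dist x y = norm (x - y)" by (rule dist_ell2_def)
  show "sgn x = x /\<^sub>R norm x" by (rule sgn_ell2_def)
  show "uniformity = (INF e\<in>{0 <..}. principal {(x :: 'a ell2, y). dist x y < e})"
    by (rule uniformity_ell2_def)
  show "open U \<longleftrightarrow> (\<forall>x\<in>U. \<forall>\<^sub>F (x', y) in uniformity. x' = x \<longrightarrow> y \<in> U)" for U :: "'a ell2 set"
    by (rule open_ell2_def)
  show "norm x = sqrt (x \<bullet> x)" by (rule norm_ell2_def)
  show "x \<bullet> y = y \<bullet> x"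
    unfolding inner_Re by (rule infsum_cong) simp
  show "(x + y) \<bullet> z = x \<bullet> z + y \<bullet> z"
    unfolding inner_Re infsum_add[OF summ_Re summ_Re, symmetric]
    by (rule infsum_cong) (simp add: plus_ell2.rep_eq algebra_simps)
  show "(r *\<^sub>R x) \<bullet> y = r * (x \<bullet> y)"
    unfolding inner_Re infsum_cmult_right[OF summ_Re, symmetric]
    by (rule infsum_cong) (simp add: scaleR_ell2.rep_eq algebra_simps)
  show "0 \<le> x \<bullet> x"
    unfolding inner_Re by (rule infsum_nonneg) simp
  show "x \<bullet> x = 0 \<longleftrightarrow> x = 0"
  proof
    assume "x \<bullet> x = 0"
    then have "Re (coord x i * cnj (coord x i)) = 0" for i
      unfolding inner_Re using nonneg_infsum_le_0D[OF _ summ_Re, of x x i] by simp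
    then have "coord x i = 0" for i
      by (simp add: complex_eq_iff add_nonneg_eq_0_iff)
    then show "x = 0"
      by (auto simp: coord_inject[symmetric] zero_ell2.rep_eq)
  qed (simp add: inner_Re zero_ell2.rep_eq)
qed

end

lift_definition ell2_scaleC :: "complex \<Rightarrow> 'i ell2 \<Rightarrow> 'i ell2" is "\<lambda>c x i. c * x i"
  by (rule ell2_summable_scale)

text \<open>The orthogonal projection of \<open>\<ell>\<^sub>2\<close> onto the elements supported in \<open>A\<close>.\<close>

lift_definition ell2_proj :: "'i set \<Rightarrow> 'i ell2 \<Rightarrow> 'i ell2" is "\<lambda>A x i. if i \<in> A then x i else 0"
  by (rule summable_on_comparison_test) auto


section \<open>Krein spaces\<close>

text \<open>Forms are linear in the first argument. The locale is the purely algebraic part of a Krein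
  space together with a chosen fundamental decomposition; completeness is added in
  \<open>krein_space\<close> below.\<close>

locale fundamental_decomposition = vector_space scaleC
  for scaleC :: "complex \<Rightarrow> 'h::ab_group_add \<Rightarrow> 'h" +
  fixes form :: "'h \<Rightarrow> 'h \<Rightarrow> complex"
    and Hp Hm :: "'h set"
  assumes form_add_left: "form (x + y) z = form x z + form y z"
    and form_scale_left: "form (scaleC c x) y = c * form x y"
    and form_hermitian: "form y x = cnj (form x y)"
    and subspace_Hp: "module.subspace scaleC Hp"
    and subspace_Hm: "module.subspace scaleC Hm"
    and Hp_Int_Hm: "Hp \<inter> Hm = {0}"
    and Hp_plus_Hm: "\<exists>u\<in>Hp. \<exists>v\<in>Hm. x = u + v"
    and form_Hp_Hm: "u \<in> Hp \<Longrightarrow> v \<in> Hm \<Longrightarrow> form u v = 0"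
    and form_pos: "u \<in> Hp \<Longrightarrow> u \<noteq> 0 \<Longrightarrow> Re (form u u) > 0"
    and form_neg: "v \<in> Hm \<Longrightarrow> v \<noteq> 0 \<Longrightarrow> Re (form v v) < 0"
begin

definition pos_part :: "'h \<Rightarrow> 'h"
  where "pos_part x = (THE u. u \<in> Hp \<and> x - u \<in> Hm)"

definition neg_part :: "'h \<Rightarrow> 'h"
  where "neg_part x = x - pos_part x"

definition cinner :: "'h \<Rightarrow> 'h \<Rightarrow> complex"
  where "cinner x y = form (pos_part x) (pos_part y) - form (neg_part x) (neg_part y)"

end

text \<open>The type class \<open>real_inner\<close> carries the norm and topology of the Hilbert inner product
  of the chosen decomposition: its scalar multiplication is the restriction of \<open>scaleC\<close> and its
  inner product is the real part of \<open>cinner\<close>, so \<open>(norm x)\<^sup>2 = cinner x x\<close>. On \<open>Hp\<close> and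
  \<open>Hm\<close> this norm is the one induced by \<open>form\<close> and \<open>- form\<close>, respectively.\<close>

locale krein_space = fundamental_decomposition scaleC form Hp Hm
  for scaleC :: "complex \<Rightarrow> 'h::real_inner \<Rightarrow> 'h"
    and form :: "'h \<Rightarrow> 'h \<Rightarrow> complex"
    and Hp Hm :: "'h set" +
  assumes scaleC_of_real: "scaleC (complex_of_real r) x = r *\<^sub>R x"
    and inner_eq_Re_cinner: "x \<bullet> y = Re (cinner x y)"
    and complete_Hp: "complete Hp"
    and complete_Hm: "complete Hm"

definition orth_companion :: "('k \<Rightarrow> 'k \<Rightarrow> complex) \<Rightarrow> 'k set \<Rightarrow> 'k set"
  where "orth_companion form A = {x. \<forall>s\<in>A. form x s = 0}"

definition null_space :: "('k \<Rightarrow> 'l::zero) \<Rightarrow> 'k set"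
  where "null_space T = {x. T x = 0}"

text \<open>The adjoint \<open>T\<^sup>+\<close> of \<open>T\<close>, where \<open>formK\<close> and \<open>formH\<close> are the (nondegenerate) forms on the
  domain and on the codomain of \<open>T\<close>.\<close>

definition krein_adjoint ::
    "('k \<Rightarrow> 'k \<Rightarrow> complex) \<Rightarrow> ('h \<Rightarrow> 'h \<Rightarrow> complex) \<Rightarrow> ('k \<Rightarrow> 'h) \<Rightarrow> 'h \<Rightarrow> 'k"
  where "krein_adjoint formK formH T = (THE A. \<forall>x y. formH (T x) y = formK x (A y))"

definition bounded_clinear ::
    "(complex \<Rightarrow> 'k \<Rightarrow> 'k) \<Rightarrow> (complex \<Rightarrow> 'h \<Rightarrow> 'h) \<Rightarrow>
      ('k::real_normed_vector \<Rightarrow> 'h::real_normed_vector) \<Rightarrow> bool"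
  where "bounded_clinear sK sH T \<longleftrightarrow> Vector_Spaces.linear sK sH T \<and> bounded_linear T"


section \<open>J-frames\<close>

text \<open>Since \<open>form\<close> is hermitian, \<open>form x x\<close> is real. The index set \<open>I\<close> of a family is the type
  \<open>'i\<close>. The infinite sums are unconditional.\<close>

context krein_space
begin

definition uniformly_J_positive :: "'h set \<Rightarrow> bool"
  where "uniformly_J_positive A \<longleftrightarrow> module.subspace scaleC A \<and>
    (\<exists>\<alpha>>0. \<forall>x\<in>A. Re (form x x) \<ge> \<alpha> * (norm x)\<^sup>2)"

definition uniformly_J_negative :: "'h set \<Rightarrow> bool"
  where "uniformly_J_negative A \<longleftrightarrow> module.subspace scaleC A \<and>
    (\<exists>\<alpha>>0. \<forall>x\<in>A. - Re (form x x) \<ge> \<alpha> * (norm x)\<^sup>2)"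

definition maximal_uniformly_J_positive :: "'h set \<Rightarrow> bool"
  where "maximal_uniformly_J_positive A \<longleftrightarrow> uniformly_J_positive A \<and>
    (\<forall>B. uniformly_J_positive B \<and> A \<subseteq> B \<longrightarrow> B = A)"

definition maximal_uniformly_J_negative :: "'h set \<Rightarrow> bool"
  where "maximal_uniformly_J_negative A \<longleftrightarrow> uniformly_J_negative A \<and>
    (\<forall>B. uniformly_J_negative B \<and> A \<subseteq> B \<longrightarrow> B = A)"

definition bessel_family :: "('i \<Rightarrow> 'h) \<Rightarrow> bool"
  where "bessel_family f \<longleftrightarrow> (\<exists>\<beta>>0. \<forall>x.
    (\<lambda>i. (cmod (cinner x (f i)))\<^sup>2) summable_on UNIV \<and>
    (\<Sum>\<^sub>\<infinity>i. (cmod (cinner x (f i)))\<^sup>2) \<le> \<beta> * (norm x)\<^sup>2)"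

definition synthesis :: "('i \<Rightarrow> 'h) \<Rightarrow> 'i ell2 \<Rightarrow> 'h"
  where "synthesis f x = (\<Sum>\<^sub>\<infinity>i. scaleC (coord x i) (f i))"

definition index_pos :: "('i \<Rightarrow> 'h) \<Rightarrow> 'i set"
  where "index_pos f = {i. Re (form (f i) (f i)) \<ge> 0}"

definition index_neg :: "('i \<Rightarrow> 'h) \<Rightarrow> 'i set"
  where "index_neg f = {i. Re (form (f i) (f i)) < 0}"

definition J_frame :: "('i \<Rightarrow> 'h) \<Rightarrow> bool"
  where "J_frame f \<longleftrightarrow> bessel_family f \<and>
    maximal_uniformly_J_positive (range (synthesis f \<circ> ell2_proj (index_pos f))) \<and>
    maximal_uniformly_J_negative (range (synthesis f \<circ> ell2_proj (index_neg f)))"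

definition ell2_form :: "('i \<Rightarrow> 'h) \<Rightarrow> 'i ell2 \<Rightarrow> 'i ell2 \<Rightarrow> complex"
  where "ell2_form f x y =
    (\<Sum>\<^sub>\<infinity>i\<in>index_pos f. coord x i * cnj (coord y i)) -
    (\<Sum>\<^sub>\<infinity>i\<in>index_neg f. coord x i * cnj (coord y i))"

definition J_frame_operator :: "('i \<Rightarrow> 'h) \<Rightarrow> 'h \<Rightarrow> 'h"
  where "J_frame_operator f = synthesis f \<circ> krein_adjoint (ell2_form f) form (synthesis f)"

text \<open>The sign of \<open>[x,x]\<close>; unlike the library function \<open>sgn\<close> it is \<open>1\<close> for neutral vectors.\<close>

definition form_sgn :: "'h \<Rightarrow> real"
  where "form_sgn x = (if Re (form x x) \<ge> 0 then 1 else - 1)"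

text \<open>The sign condition does not follow from the two reconstruction formulas: for \<open>H = \<complex>\<close>
  with \<open>[x,y] = - x * cnj y\<close> and \<open>f = (1, 1)\<close>, the family \<open>g = (1, 0)\<close> satisfies both, but
  \<open>g\<close> has signs \<open>(-1, 1)\<close>.\<close>

definition dual_family :: "('i \<Rightarrow> 'h) \<Rightarrow> ('i \<Rightarrow> 'h) \<Rightarrow> bool"
  where "dual_family f g \<longleftrightarrow> bessel_family g \<and> (\<forall>i. form_sgn (f i) = form_sgn (g i)) \<and>
    (\<forall>x. ((\<lambda>i. scaleC (complex_of_real (form_sgn (f i)) * form x (f i)) (g i)) has_sum x) UNIV \<and>
         ((\<lambda>i. scaleC (complex_of_real (form_sgn (f i)) * form x (g i)) (f i)) has_sum x) UNIV)"

end

end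

theory Submission
  imports Defs
begin

text \<open>Write \<open>T\<^sup>+\<close> for the adjoint with respect to the indefinite forms, so that
  \<open>S = T T\<^sup>+\<close>.  The coordinates of \<open>T\<^sup>+ x\<close> are \<open>\<sigma>\<^sub>i [x, f\<^sub>i]\<close>, and since \<open>f\<close> and \<open>g\<close> have the same
  signs, the two reconstruction formulas say \<open>V T\<^sup>+ = id\<close> and \<open>T V\<^sup>+ = id\<close>.  These are adjoint to
  each other, so \<open>g\<close> is dual to \<open>f\<close> if and only if \<open>V T\<^sup>+ = id\<close> (\<open>dual_family_iff\<close>).  As
  \<open>S\<^sup>-\<^sup>1 T T\<^sup>+ = id\<close>, this means that \<open>W = V - S\<^sup>-\<^sup>1 T\<close> vanishes on the range of \<open>T\<^sup>+\<close>, and this range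
  is exactly \<open>N(T)\<^sup>[\<^sup>\<bottom>\<^sup>]\<close>, because \<open>id - T\<^sup>+ S\<^sup>-\<^sup>1 T\<close> projects onto \<open>N(T)\<close> along it
  (\<open>orth_companion_null_space_synthesis\<close>).

  The analytic content is that \<open>S\<close> is bijective with bounded inverse
  (\<open>J_frame_operator_bij\<close>).  Let \<open>M\<^sub>+\<close> and \<open>M\<^sub>-\<close> be the two maximal uniformly definite ranges.

  \<^item> From \<open>Re [u + v, u - v] = [u, u] - [v, v]\<close> follows \<open>norm (u - v) \<le> C * norm (u + v)\<close> for
    \<open>u \<in> M\<^sub>+\<close> and \<open>v \<in> M\<^sub>-\<close>, so the sum \<open>M\<^sub>+ + M\<^sub>-\<close> is topologically direct
    (\<open>definite_pair_norm_le\<close>), and maximality makes it the whole space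
    (\<open>maximal_pair_sum_UNIV\<close>).

  \<^item> Hence \<open>T\<close> is surjective.  By uniform boundedness its Hilbert space adjoint \<open>T\<^sup>*\<close>, the
    function \<open>analysis f\<close>, is bounded below (\<open>synthesis_surj_imp_lower_frame_bound\<close>), so
    \<open>T T\<^sup>*\<close> is coercive and therefore surjective (\<open>coercive_surj\<close>).

  \<^item> If \<open>T T\<^sup>* (J y) = u + v\<close> with \<open>u \<in> M\<^sub>+\<close> and \<open>v \<in> M\<^sub>-\<close>, then \<open>S y = u - v\<close>.  The norm
    inequality transfers injectivity, surjectivity and the lower bound from \<open>T T\<^sup>*\<close> to \<open>S\<close>.\<close>


section \<open>Complete inner product spaces\<close>

text \<open>A minimising sequence for the distance is Cauchy by the parallelogram law; optimality of the
  limit against \<open>d + t e\<close> gives orthogonality.\<close>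

lemma orthogonal_projection_exists:
  fixes D :: "'a::real_inner set"
  assumes "subspace D" and "complete D"
  obtains d where "d \<in> D" and "\<And>e. e \<in> D \<Longrightarrow> (x - d) \<bullet> e = 0"
proof -
  define \<delta> where "\<delta> = Inf ((\<lambda>d. (norm (x - d))\<^sup>2) ` D)"
  have bdd: "bdd_below ((\<lambda>d. (norm (x - d))\<^sup>2) ` D)"
    by (rule bdd_belowI[of _ 0]) auto
  have lower: "\<delta> \<le> (norm (x - d))\<^sup>2" if "d \<in> D" for d
    unfolding \<delta>_def using that by (intro cInf_lower bdd) auto
  have "\<exists>d\<in>D. (norm (x - d))\<^sup>2 < \<delta> + 1 / Suc n" for n
  proof -
    have "D \<noteq> {}" using assms(1) subspace_0 by auto
    then show ?thesis
      using cInf_lessD[of "(\<lambda>d. (norm (x - d))\<^sup>2) ` D" "\<delta> + 1 / Suc n"]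
      by (auto simp: \<delta>_def)
  qed
  then obtain d where d: "\<And>n. d n \<in> D" "\<And>n. (norm (x - d n))\<^sup>2 < \<delta> + 1 / Suc n"
    by metis
  have gap: "(norm (d m - d n))\<^sup>2 \<le> 2 / Suc m + 2 / Suc n" for m n
  proof -
    have "(1/2) *\<^sub>R (d m + d n) \<in> D"
      using assms(1) d(1) by (intro subspace_scale subspace_add)
    from lower[OF this]
    have "\<delta> \<le> (norm (x - (1/2) *\<^sub>R (d m + d n)))\<^sup>2" .
    moreover have "(norm (d m - d n))\<^sup>2 =
        2 * (norm (x - d m))\<^sup>2 + 2 * (norm (x - d n))\<^sup>2 - 4 * (norm (x - (1/2) *\<^sub>R (d m + d n)))\<^sup>2"
      unfolding power2_norm_eq_inner
      by (simp add: inner_diff_left inner_diff_right inner_add_left inner_add_right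
          inner_commute algebra_simps)
    ultimately show ?thesis using d(2)[of m] d(2)[of n] by linarith
  qed
  have "Cauchy d"
  proof (rule metric_CauchyI)
    fix e :: real assume "e > 0"
    then obtain N where N: "4 / e\<^sup>2 < real N" using reals_Archimedean2 by blast
    have "dist (d m) (d n) < e" if "m \<ge> N" "n \<ge> N" for m n
    proof -
      have "0 < 4 / e\<^sup>2" using \<open>e > 0\<close> by simp
      with N have Npos: "real N > 0" by linarith
      have "2 / Suc m \<le> 2 / real N" "2 / Suc n \<le> 2 / real N"
        using that Npos by (auto intro!: divide_left_mono)
      then have "(norm (d m - d n))\<^sup>2 \<le> 4 / real N"
        using gap[of m n] by linarith
      also have "\<dots> < e\<^sup>2" using N Npos \<open>e > 0\<close> by (simp add: field_simps)
      finally show ?thesis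
        unfolding dist_norm by (rule power2_less_imp_less) (use \<open>e > 0\<close> in simp)
    qed
    then show "\<exists>N. \<forall>m\<ge>N. \<forall>n\<ge>N. dist (d m) (d n) < e" by blast
  qed
  then obtain l where l: "l \<in> D" "d \<longlonglongrightarrow> l"
    using assms(2) d(1) unfolding complete_def by blast
  have "(\<lambda>n. (norm (x - d n))\<^sup>2) \<longlonglongrightarrow> (norm (x - l))\<^sup>2"
    by (intro tendsto_intros l)
  moreover have "(\<lambda>n. \<delta> + 1 / Suc n) \<longlonglongrightarrow> \<delta> + 0"
    by (intro tendsto_intros LIMSEQ_Suc[OF lim_1_over_n])
  ultimately have "(norm (x - l))\<^sup>2 \<le> \<delta> + 0"
    by (rule LIMSEQ_le) (use d(2) in \<open>blast intro: less_imp_le\<close>)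
  then have upper: "(norm (x - l))\<^sup>2 \<le> \<delta>" by simp
  have "(x - l) \<bullet> e = 0" if e: "e \<in> D" for e
  proof (cases "e = 0")
    case False
    define t where "t = ((x - l) \<bullet> e) / (e \<bullet> e)"
    have "l + t *\<^sub>R e \<in> D" using assms(1) l(1) e by (intro subspace_add subspace_scale)
    from lower[OF this] upper have "(norm (x - l))\<^sup>2 \<le> (norm ((x - l) - t *\<^sub>R e))\<^sup>2"
      by (simp only: diff_diff_eq)
    also have "\<dots> = (norm (x - l))\<^sup>2 - ((x - l) \<bullet> e)\<^sup>2 / (e \<bullet> e)"
      using False unfolding power2_norm_eq_inner inner_diff_left[of "x - l" "t *\<^sub>R e"]
        inner_diff_right[of _ "x - l" "t *\<^sub>R e"]
      by (simp add: t_def inner_commute power2_eq_square)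
    finally have "((x - l) \<bullet> e)\<^sup>2 / (e \<bullet> e) \<le> 0" by simp
    moreover have "0 < e \<bullet> e" using False by simp
    ultimately show ?thesis by (simp add: divide_le_0_iff)
  qed simp
  with l(1) that show thesis by blast
qed

text \<open>For small \<open>t\<close> the map \<open>z \<mapsto> z - t (B z - h)\<close> is a contraction, and its fixed point solves
  \<open>B z = h\<close>.\<close>

lemma coercive_surj:
  fixes B :: "'a::real_inner \<Rightarrow> 'a"
  assumes compl: "complete (UNIV :: 'a set)" and B: "bounded_linear B"
    and c: "c > 0" "\<And>z. c * (norm z)\<^sup>2 \<le> B z \<bullet> z"
  shows "surj B"
proof -
  obtain b where b: "b > 0" "\<And>z. norm (B z) \<le> norm z * b"
    using bounded_linear.pos_bounded[OF B] by blast
  have lin: "linear B" using B by (simp add: bounded_linear.linear)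
  \<comment> \<open>Enlarging \<open>b\<close> to \<open>b + c\<close> ensures \<open>c < b'\<close>, so that \<open>q = 1 - c\<^sup>2 / b'\<^sup>2\<close> is nonnegative.\<close>
  define b' where "b' = b + c"
  have b': "b' > 0" "c < b'" using b(1) c(1) by (auto simp: b'_def)
  have Bb': "norm (B z) \<le> b' * norm z" for z
  proof -
    have "norm (B z) \<le> norm z * b" by (rule b(2))
    also have "\<dots> \<le> b' * norm z" using c(1) by (simp add: b'_def algebra_simps)
    finally show ?thesis .
  qed
  \<comment> \<open>This step size minimises the bound \<open>1 - 2 t c + t\<^sup>2 b'\<^sup>2\<close> on the squared contraction
    factor; the minimum is \<open>q\<close>.\<close>
  define t where "t = c / b'\<^sup>2"
  define q where "q = 1 - c\<^sup>2 / b'\<^sup>2"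
  have "c\<^sup>2 < b'\<^sup>2" using b' c(1) by (intro power_strict_mono) auto
  then have q: "0 \<le> q" "q < 1" using b' c(1) by (auto simp: q_def)
  have t: "t > 0" using c(1) b' by (simp add: t_def)
  have contr: "norm (z - t *\<^sub>R B z) \<le> sqrt q * norm z" for z
  proof -
    have "(norm (z - t *\<^sub>R B z))\<^sup>2 = (norm z)\<^sup>2 - 2 * t * (B z \<bullet> z) + t\<^sup>2 * (norm (B z))\<^sup>2"
      unfolding power2_norm_eq_inner
      by (simp add: inner_diff_left inner_diff_right inner_commute power2_eq_square algebra_simps)
    also have "\<dots> \<le> (norm z)\<^sup>2 - 2 * t * (c * (norm z)\<^sup>2) + t\<^sup>2 * (b' * norm z)\<^sup>2"
    proof -
      have "t * (c * (norm z)\<^sup>2) \<le> t * (B z \<bullet> z)" using c(2) t by simp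
      moreover have "t\<^sup>2 * (norm (B z))\<^sup>2 \<le> t\<^sup>2 * (b' * norm z)\<^sup>2"
        using Bb' by (intro mult_left_mono power_mono) auto
      ultimately show ?thesis by linarith
    qed
    also have "\<dots> = q * (norm z)\<^sup>2"
      using b' by (simp add: t_def q_def power_mult_distrib field_simps power2_eq_square)
    also have "\<dots> = (sqrt q * norm z)\<^sup>2" using q by (simp add: power_mult_distrib)
    finally show ?thesis
      by (rule power2_le_imp_le) (use q in auto)
  qed
  show ?thesis
    unfolding surj_def
  proof
    fix h
    define \<Phi> where "\<Phi> z = z - t *\<^sub>R (B z - h)" for z
    have "dist (\<Phi> y) (\<Phi> z) \<le> sqrt q * dist y z" for y z
    proof -
      have "\<Phi> y - \<Phi> z = (y - z) - t *\<^sub>R B (y - z)"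
        by (simp add: \<Phi>_def linear_diff[OF lin] algebra_simps)
      then show ?thesis using contr[of "y - z"] by (simp add: dist_norm)
    qed
    moreover have "0 \<le> sqrt q" "sqrt q < 1" using q by auto
    ultimately have "\<exists>!z\<in>UNIV. \<Phi> z = z"
      using Banach_fix[OF compl UNIV_not_empty, of "sqrt q" \<Phi>] by blast
    then obtain z where "\<Phi> z = z" by blast
    then show "\<exists>z. h = B z" using t by (auto simp: \<Phi>_def)
  qed
qed

text \<open>Uniform boundedness by a gliding hump.  If \<open>norm (y n) \<ge> 4 ^ n\<close>, moving a point by at most
  \<open>3 ^ -n\<close> makes its product with \<open>y n\<close> at least \<open>3 ^ -n * norm (y n)\<close>, and all later moves
  together undo at most half of this.\<close>

lemma weakly_bounded_imp_bounded:
  fixes A :: "'a::real_inner set"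
  assumes compl: "complete (UNIV :: 'a set)"
    and weak: "\<And>h. \<exists>K. \<forall>y\<in>A. \<bar>h \<bullet> y\<bar> \<le> K"
  shows "\<exists>C. \<forall>y\<in>A. norm y \<le> C"
proof (rule ccontr)
  assume "\<not> ?thesis"
  then have "\<forall>n. \<exists>y\<in>A. 4 ^ n \<le> norm y" by (meson le_cases)
  then obtain y where y: "\<And>n. y n \<in> A" "\<And>n. 4 ^ n \<le> norm (y n)"
    by metis
  have "\<exists>x'. norm (x' - x) \<le> r \<and> r * norm v \<le> \<bar>x' \<bullet> v\<bar>" if "r > 0" for x v :: 'a and r :: real
  proof (cases "v = 0")
    case True
    then show ?thesis using that by (intro exI[of _ x]) auto
  next
    case False
    define w where "w = (r / norm v) *\<^sub>R v"
    have w: "norm w = r" "w \<bullet> v = r * norm v"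
      using False that by (auto simp: w_def dot_square_norm power2_eq_square)
    have "r * norm v \<le> \<bar>(x + w) \<bullet> v\<bar> \<or> r * norm v \<le> \<bar>(x - w) \<bullet> v\<bar>"
      by (simp add: inner_add_left inner_diff_left w(2)) linarith
    then show ?thesis
    proof
      assume "r * norm v \<le> \<bar>(x + w) \<bullet> v\<bar>"
      then show ?thesis using w by (intro exI[of _ "x + w"]) auto
    next
      assume "r * norm v \<le> \<bar>(x - w) \<bullet> v\<bar>"
      then show ?thesis using w by (intro exI[of _ "x - w"]) auto
    qed
  qed
  then have "\<forall>x n. \<exists>x'. norm (x' - x) \<le> (1/3) ^ n \<and> (1/3) ^ n * norm (y n) \<le> \<bar>x' \<bullet> y n\<bar>"
    by auto
  then obtain G where G: "\<And>x n. norm (G x n - x) \<le> (1/3) ^ n"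
      "\<And>x n. (1/3) ^ n * norm (y n) \<le> \<bar>G x n \<bullet> y n\<bar>"
    by metis
  define X where "X = rec_nat 0 (\<lambda>n x. G x n)"
  have X_Suc: "X (Suc n) = G (X n) n" for n by (simp add: X_def)
  have tail: "norm (X (n + k) - X n) \<le> 3/2 * (1/3) ^ n * (1 - (1/3) ^ k)" for n k
  proof (induction k)
    case (Suc k)
    have "norm (X (n + Suc k) - X n) \<le> norm (X (Suc (n + k)) - X (n + k)) + norm (X (n + k) - X n)"
      using norm_triangle_ineq[of "X (Suc (n + k)) - X (n + k)" "X (n + k) - X n"] by simp
    also have "\<dots> \<le> (1/3) ^ (n + k) + 3/2 * (1/3) ^ n * (1 - (1/3) ^ k)"
      unfolding X_Suc by (intro add_mono G Suc)
    also have "\<dots> = 3/2 * (1/3) ^ n * (1 - (1/3) ^ Suc k)"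
      by (simp add: power_add field_simps)
    finally show ?case .
  qed simp
  have tail': "norm (X m - X n) \<le> 3/2 * (1/3) ^ n" if "n \<le> m" for m n
  proof -
    have "norm (X m - X n) \<le> 3/2 * (1/3) ^ n * (1 - (1/3) ^ (m - n))"
      using tail[of n "m - n"] that by simp
    also have "\<dots> \<le> 3/2 * (1/3) ^ n * 1" by (intro mult_left_mono) auto
    finally show ?thesis by simp
  qed
  have "Cauchy X"
  proof (rule metric_CauchyI)
    fix e :: real assume "e > 0"
    have "(\<lambda>n. 3 * (1/3 :: real) ^ n) \<longlonglongrightarrow> 3 * 0"
      by (intro tendsto_intros LIMSEQ_realpow_zero) auto
    then obtain N where N: "3 * (1/3 :: real) ^ N < e"
      using \<open>e > 0\<close> by (auto simp: LIMSEQ_iff dest: spec[of _ e])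
    have "dist (X m) (X n) < e" if "m \<ge> N" "n \<ge> N" for m n
      using norm_triangle_ineq4[of "X m - X N" "X n - X N"] tail'[OF that(1)] tail'[OF that(2)] N
      by (simp add: dist_norm)
    then show "\<exists>N. \<forall>m\<ge>N. \<forall>n\<ge>N. dist (X m) (X n) < e" by blast
  qed
  then obtain x where x: "X \<longlonglongrightarrow> x"
    using compl unfolding complete_def by blast
  obtain K where K: "\<And>n. \<bar>x \<bullet> y n\<bar> \<le> K" using weak[of x] y(1) by blast
  have big: "(4/3) ^ n / 2 \<le> K" for n
  proof -
    have "(\<lambda>m. norm (X m - X (Suc n))) \<longlonglongrightarrow> norm (x - X (Suc n))"
      by (intro tendsto_intros x)
    then have "norm (x - X (Suc n)) \<le> 3/2 * (1/3) ^ Suc n"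
      by (rule LIMSEQ_le_const2) (use tail' in blast)
    then have dx: "norm (x - X (Suc n)) \<le> 1/2 * (1/3) ^ n" by simp
    have "\<bar>(x - X (Suc n)) \<bullet> y n\<bar> \<le> norm (x - X (Suc n)) * norm (y n)"
      by (rule Cauchy_Schwarz_ineq2)
    also have "\<dots> \<le> 1/2 * (1/3) ^ n * norm (y n)"
      by (intro mult_right_mono dx) simp
    finally have "\<bar>(x - X (Suc n)) \<bullet> y n\<bar> \<le> 1/2 * ((1/3) ^ n * norm (y n))" by simp
    moreover have "(1/3) ^ n * norm (y n) \<le> \<bar>X (Suc n) \<bullet> y n\<bar>"
      unfolding X_Suc by (rule G)
    ultimately have "1/2 * ((1/3) ^ n * norm (y n)) \<le> \<bar>x \<bullet> y n\<bar>"
      unfolding inner_diff_left by linarith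
    moreover have "(1/3) ^ n * 4 ^ n \<le> (1/3) ^ n * norm (y n)"
      by (intro mult_left_mono y) simp
    moreover have "(1/3 :: real) ^ n * 4 ^ n = (4/3) ^ n"
      by (simp flip: power_mult_distrib)
    ultimately show ?thesis using K[of n] by linarith
  qed
  obtain n where "2 * K < (4/3) ^ n" using real_arch_pow[of "4/3" "2 * K"] by auto
  with big[of n] show False by linarith
qed

text \<open>The partial sums of \<open>u\<close> form a Cauchy filter because those of \<open>a\<close> do.\<close>

lemma summable_on_if_square_dominated:
  fixes u :: "'i \<Rightarrow> 'a::real_inner" and a :: "'i \<Rightarrow> real"
  assumes compl: "complete (UNIV :: 'a set)"
    and dom: "\<And>F. finite F \<Longrightarrow> (norm (sum u F))\<^sup>2 \<le> C * sum a F"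
    and a: "a summable_on UNIV" "\<And>i. 0 \<le> a i" and C: "C > 0"
  shows "u summable_on UNIV"
proof -
  have "cauchy_filter (filtermap (sum u) (finite_subsets_at_top UNIV))"
    unfolding cauchy_filter_metric_filtermap
  proof (intro allI impI)
    fix e :: real assume e: "e > 0"
    have "(sum a \<longlongrightarrow> infsum a UNIV) (finite_subsets_at_top UNIV)"
      using has_sum_infsum[OF a(1)] unfolding has_sum_def .
    moreover have "infsum a UNIV - e\<^sup>2 / (4 * C) < infsum a UNIV" using e C by simp
    ultimately have
      "\<forall>\<^sub>F F in finite_subsets_at_top UNIV. infsum a UNIV - e\<^sup>2 / (4 * C) < sum a F"
      by (simp add: order_tendsto_iff)
    then obtain F0 where F0: "finite F0" "infsum a UNIV - e\<^sup>2 / (4 * C) < sum a F0"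
      unfolding eventually_finite_subsets_at_top by blast
    define P where "P F \<longleftrightarrow> finite F \<and> F0 \<subseteq> F" for F
    have near: "norm (sum u F - sum u F0) < e / 2" if "P F" for F
    proof -
      have F: "finite F" "F0 \<subseteq> F" using that by (auto simp: P_def)
      have "(norm (sum u F - sum u F0))\<^sup>2 = (norm (sum u (F - F0)))\<^sup>2"
        using F by (simp add: sum_diff)
      also have "\<dots> \<le> C * sum a (F - F0)" using F by (intro dom) auto
      also have "\<dots> = C * (sum a F - sum a F0)" using F F0 by (simp add: sum_diff)
      also have "\<dots> \<le> C * (infsum a UNIV - sum a F0)"
        using C F finite_sum_le_infsum[OF a(1), of F] a(2) by (intro mult_left_mono) auto
      also have "\<dots> < C * (e\<^sup>2 / (4 * C))"
        using C F0 by (intro mult_strict_left_mono) auto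
      also have "\<dots> = (e / 2)\<^sup>2" using C by (simp add: power2_eq_square)
      finally show ?thesis
        by (rule power2_less_imp_less) (use e in simp)
    qed
    have "eventually P (finite_subsets_at_top UNIV)"
      unfolding eventually_finite_subsets_at_top P_def using F0(1) by auto
    moreover have "dist (sum u F) (sum u G) < e" if "P F" "P G" for F G
      using dist_triangle_half_l[of "sum u F" "sum u F0" e "sum u G"] near[OF that(1)] near[OF that(2)]
      by (simp add: dist_norm)
    ultimately show "\<exists>P. eventually P (finite_subsets_at_top UNIV) \<and>
        (\<forall>F G. P F \<and> P G \<longrightarrow> dist (sum u F) (sum u G) < e)" by blast
  qed
  then obtain l where "filtermap (sum u) (finite_subsets_at_top UNIV) \<le> nhds l"
    using cauchy_filter_complete_converges[OF _ compl] by (force simp: filtermap_bot_iff)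
  then have "(sum u \<longlongrightarrow> l) (finite_subsets_at_top UNIV)"
    unfolding filterlim_def .
  then show ?thesis
    unfolding summable_on_def has_sum_def by blast
qed

section \<open>Algebra and geometry of a Krein space\<close>

context krein_space
begin

lemma pos_part_eqI:
  assumes "u \<in> Hp" and "x - u \<in> Hm"
  shows "pos_part x = u"
  unfolding pos_part_def
proof (rule the_equality)
  fix v assume v: "v \<in> Hp \<and> x - v \<in> Hm"
  have "v - u \<in> Hp" using subspace_diff[OF subspace_Hp] v assms by blast
  moreover have "(x - u) - (x - v) \<in> Hm" using subspace_diff[OF subspace_Hm] v assms by blast
  then have "v - u \<in> Hm" by simp
  ultimately have "v - u \<in> Hp \<inter> Hm" by blast
  then show "v = u" by (simp add: Hp_Int_Hm)
qed (use assms in blast)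

lemma pos_part_in: "pos_part x \<in> Hp" and neg_part_in: "neg_part x \<in> Hm"
proof -
  obtain u v where uv: "u \<in> Hp" "v \<in> Hm" "x = u + v" using Hp_plus_Hm[of x] by blast
  then have "pos_part x = u" by (intro pos_part_eqI) auto
  with uv show "pos_part x \<in> Hp" "neg_part x \<in> Hm" by (auto simp: neg_part_def)
qed

lemma pos_part_plus_neg_part: "pos_part x + neg_part x = x"
  by (simp add: neg_part_def)

lemma pos_part_add: "pos_part (x + y) = pos_part x + pos_part y"
proof (rule pos_part_eqI)
  show "pos_part x + pos_part y \<in> Hp"
    by (rule subspace_add[OF subspace_Hp pos_part_in pos_part_in])
  have "neg_part x + neg_part y \<in> Hm"
    by (rule subspace_add[OF subspace_Hm neg_part_in neg_part_in])
  then show "x + y - (pos_part x + pos_part y) \<in> Hm"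
    by (simp add: neg_part_def algebra_simps)
qed

lemma pos_part_scale: "pos_part (scaleC c x) = scaleC c (pos_part x)"
proof (rule pos_part_eqI)
  show "scaleC c (pos_part x) \<in> Hp"
    by (rule subspace_scale[OF subspace_Hp pos_part_in])
  have "scaleC c (neg_part x) \<in> Hm"
    by (rule subspace_scale[OF subspace_Hm neg_part_in])
  then show "scaleC c x - scaleC c (pos_part x) \<in> Hm"
    by (simp add: neg_part_def scale_right_diff_distrib)
qed

lemma form_add_right: "form z (x + y) = form z x + form z y"
  by (simp add: form_hermitian[of z] form_add_left)

lemma form_scale_right: "form x (scaleC c y) = cnj c * form x y"
  by (simp add: form_hermitian[of x] form_scale_left)

lemma form_zero_left [simp]: "form 0 x = 0"
  using form_add_left[of 0 0 x] by simp

lemma form_zero_right [simp]: "form x 0 = 0"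
  using form_add_right[of x 0 0] by simp

lemma form_minus_left: "form (- x) y = - form x y"
  using form_add_left[of x "- x" y] by (simp add: eq_neg_iff_add_eq_0 add.commute)

lemma form_minus_right: "form x (- y) = - form x y"
  using form_add_right[of x y "- y"] by (simp add: eq_neg_iff_add_eq_0 add.commute)

lemma form_diff_left: "form (x - y) z = form x z - form y z"
  using form_add_left[of x "- y" z] by (simp add: form_minus_left)

lemma form_diff_right: "form z (x - y) = form z x - form z y"
  using form_add_right[of z x "- y"] by (simp add: form_minus_right)

lemma form_Hm_Hp: "v \<in> Hm \<Longrightarrow> u \<in> Hp \<Longrightarrow> form v u = 0"
  using form_hermitian[of v u] form_Hp_Hm[of u v] by simp

lemma Re_form_commute: "Re (form x y) = Re (form y x)"
  using form_hermitian[of x y] by simp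

text \<open>The operator \<open>J\<close> that exchanges the indefinite form with the Hilbert inner product.\<close>

definition fundamental_symmetry :: "'h \<Rightarrow> 'h"
  where "fundamental_symmetry x = pos_part x - neg_part x"

lemma form_fundamental_symmetry_left: "form (fundamental_symmetry x) y = cinner x y"
  by (subst pos_part_plus_neg_part[of y, symmetric])
    (simp add: fundamental_symmetry_def cinner_def form_add_right form_diff_left form_Hp_Hm
      form_Hm_Hp pos_part_in neg_part_in)

lemma form_fundamental_symmetry_right: "form x (fundamental_symmetry y) = cinner x y"
  by (subst pos_part_plus_neg_part[of x, symmetric])
    (simp add: fundamental_symmetry_def cinner_def form_add_left form_diff_right form_Hp_Hm
      form_Hm_Hp pos_part_in neg_part_in)

lemma fundamental_symmetry_involution [simp]:
  "fundamental_symmetry (fundamental_symmetry x) = x"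
proof -
  have "pos_part (fundamental_symmetry x) = pos_part x"
  proof (rule pos_part_eqI[OF pos_part_in])
    have "0 - neg_part x \<in> Hm"
      by (rule subspace_diff[OF subspace_Hm subspace_0[OF subspace_Hm] neg_part_in])
    then show "fundamental_symmetry x - pos_part x \<in> Hm"
      by (simp add: fundamental_symmetry_def)
  qed
  then show ?thesis
    by (simp add: fundamental_symmetry_def[of "fundamental_symmetry x"] neg_part_def)
      (simp add: fundamental_symmetry_def neg_part_def)
qed

lemma cinner_fundamental_symmetry_left: "cinner (fundamental_symmetry x) y = form x y"
  by (simp flip: form_fundamental_symmetry_left)

lemma cinner_fundamental_symmetry_right: "cinner x (fundamental_symmetry y) = form x y"
  by (simp flip: form_fundamental_symmetry_right)

lemma fundamental_symmetry_add:
  "fundamental_symmetry (x + y) = fundamental_symmetry x + fundamental_symmetry y"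
  by (simp add: fundamental_symmetry_def neg_part_def pos_part_add)

lemma fundamental_symmetry_scale:
  "fundamental_symmetry (scaleC c x) = scaleC c (fundamental_symmetry x)"
  by (simp add: fundamental_symmetry_def neg_part_def pos_part_scale scale_right_diff_distrib)

lemma cinner_add_left: "cinner (x + y) z = cinner x z + cinner y z"
  by (simp add: fundamental_symmetry_add form_add_left flip: form_fundamental_symmetry_left)

lemma cinner_scale_left: "cinner (scaleC c x) y = c * cinner x y"
  by (simp add: fundamental_symmetry_scale form_scale_left flip: form_fundamental_symmetry_left)

lemma cinner_commute: "cinner y x = cnj (cinner x y)"
  using form_hermitian[of y "fundamental_symmetry x"]
  by (simp add: form_fundamental_symmetry_left form_fundamental_symmetry_right)

lemma cinner_scale_right: "cinner x (scaleC c y) = cnj c * cinner x y"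
  by (simp add: cinner_commute[of x] cinner_scale_left)

lemma power2_norm_eq_Re_cinner: "(norm x)\<^sup>2 = Re (cinner x x)"
  by (simp add: power2_norm_eq_inner inner_eq_Re_cinner)

lemma Re_form_eq_inner: "Re (form x y) = x \<bullet> fundamental_symmetry y"
  by (simp add: inner_eq_Re_cinner cinner_fundamental_symmetry_right)

lemma norm_fundamental_symmetry [simp]: "norm (fundamental_symmetry x) = norm x"
proof -
  have "(norm (fundamental_symmetry x))\<^sup>2 = (norm x)\<^sup>2"
    by (simp add: power2_norm_eq_Re_cinner cinner_fundamental_symmetry_left
        form_fundamental_symmetry_right)
  then show ?thesis by simp
qed

lemma norm_scaleC: "norm (scaleC c x) = cmod c * norm x"
proof -
  have "cinner (scaleC c x) (scaleC c x) = c * (cnj c * cinner x x)"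
    by (simp add: cinner_scale_left cinner_scale_right)
  also have "\<dots> = complex_of_real ((cmod c)\<^sup>2) * cinner x x"
    by (simp only: mult.assoc[symmetric] complex_norm_square)
  finally have "(norm (scaleC c x))\<^sup>2 = (cmod c * norm x)\<^sup>2"
    by (simp add: power2_norm_eq_Re_cinner power_mult_distrib)
  then show ?thesis by simp
qed

text \<open>Multiplying \<open>x\<close> by a unimodular number makes \<open>cinner x y\<close> real, which reduces the
  complex inequality to the real one.\<close>

lemma norm_cinner_le: "cmod (cinner x y) \<le> norm x * norm y"
proof (cases "cinner x y = 0")
  case False
  define c where "c = cnj (cinner x y) / cmod (cinner x y)"
  have "cmod c = 1" using False by (simp add: c_def norm_divide)
  have "cinner (scaleC c x) y = cmod (cinner x y)"
    using False complex_norm_square[of "cinner x y"]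
    by (simp add: cinner_scale_left c_def power2_eq_square field_simps)
  then have "cmod (cinner x y) = scaleC c x \<bullet> y" by (simp add: inner_eq_Re_cinner)
  also have "\<dots> \<le> norm (scaleC c x) * norm y" by (rule norm_cauchy_schwarz)
  finally show ?thesis using \<open>cmod c = 1\<close> by (simp add: norm_scaleC)
qed simp

lemma norm_form_le: "cmod (form x y) \<le> norm x * norm y"
  using norm_cinner_le[of x "fundamental_symmetry y"]
  by (simp add: cinner_fundamental_symmetry_right)

lemma form_scaleR_left: "form (r *\<^sub>R x) y = r *\<^sub>R form x y"
  by (simp add: form_scale_left scaleR_conv_of_real flip: scaleC_of_real)

lemma bounded_linear_form_left: "bounded_linear (\<lambda>x. form x y)"
  by (rule bounded_linear_intro[of _ "norm y"])
    (simp_all add: form_add_left form_scaleR_left norm_form_le)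

lemma bounded_linear_cinner_left: "bounded_linear (\<lambda>x. cinner x y)"
  using bounded_linear_form_left[of "fundamental_symmetry y"]
  by (simp add: form_fundamental_symmetry_right)

lemma bounded_linear_scaleC: "bounded_linear (scaleC c)"
  by (rule bounded_linear_intro[of _ "cmod c"])
    (simp_all add: scale_right_distrib norm_scaleC mult.commute flip: scaleC_of_real)

lemma bounded_linear_fundamental_symmetry: "bounded_linear fundamental_symmetry"
  by (rule bounded_linear_intro[of _ 1])
    (simp_all add: fundamental_symmetry_add fundamental_symmetry_scale flip: scaleC_of_real)

lemma form_nondegenerate:
  assumes "\<And>x. form x y = 0"
  shows "y = 0"
proof -
  have "(norm y)\<^sup>2 = 0"
    using assms[of "fundamental_symmetry y"]
    by (simp add: power2_norm_eq_Re_cinner form_fundamental_symmetry_left)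
  then show ?thesis by simp
qed

text \<open>The two parts of a Cauchy sequence are Cauchy in \<open>Hp\<close> and \<open>Hm\<close>, since
  \<open>pos_part = (id + fundamental_symmetry) / 2\<close> is bounded.\<close>

lemma krein_space_complete: "complete (UNIV :: 'h set)"
  unfolding complete_def
proof (intro allI impI)
  fix X :: "nat \<Rightarrow> 'h" assume "(\<forall>n. X n \<in> UNIV) \<and> Cauchy X"
  then have X: "Cauchy X" by simp
  have half: "pos_part = (\<lambda>x. (1/2) *\<^sub>R (x + fundamental_symmetry x))"
  proof
    fix x
    have "x + fundamental_symmetry x = 2 *\<^sub>R pos_part x"
      by (simp add: fundamental_symmetry_def neg_part_def scaleR_2)
    then show "pos_part x = (1/2) *\<^sub>R (x + fundamental_symmetry x)" by simp
  qed
  have bl: "bounded_linear pos_part"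
    unfolding half
    by (intro bounded_linear_const_scaleR bounded_linear_add bounded_linear_ident
        bounded_linear_fundamental_symmetry)
  have "Cauchy (\<lambda>n. pos_part (X n))" by (rule bounded_linear.Cauchy[OF bl X])
  then obtain u where u: "(\<lambda>n. pos_part (X n)) \<longlonglongrightarrow> u"
    using completeE[OF complete_Hp, of "\<lambda>n. pos_part (X n)"] pos_part_in by metis
  have bl': "bounded_linear neg_part"
    using bounded_linear_sub[OF bounded_linear_ident bl] by (simp add: neg_part_def[abs_def])
  have "Cauchy (\<lambda>n. neg_part (X n))" by (rule bounded_linear.Cauchy[OF bl' X])
  then obtain v where v: "(\<lambda>n. neg_part (X n)) \<longlonglongrightarrow> v"
    using completeE[OF complete_Hm, of "\<lambda>n. neg_part (X n)"] neg_part_in by metis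
  have "X \<longlonglongrightarrow> u + v"
    using tendsto_add[OF u v] by (simp add: pos_part_plus_neg_part)
  then show "\<exists>l\<in>UNIV. X \<longlonglongrightarrow> l" by blast
qed

end

section \<open>Square-summable families\<close>

lemma ell2_eqI: "(\<And>i. coord x i = coord y i) \<Longrightarrow> x = y"
  by (simp add: coord_inject[symmetric] ext)

lemma ell2_mult_summable: "(\<lambda>i. coord x i * cnj (coord y i)) summable_on UNIV"
  using coord[of x] coord[of y] by (intro ell2_summable_mult) auto

lemma power2_norm_ell2: "(norm x)\<^sup>2 = (\<Sum>\<^sub>\<infinity>i. (cmod (coord x i))\<^sup>2)"
proof -
  have "(norm x)\<^sup>2 = (\<Sum>\<^sub>\<infinity>i. Re (coord x i * cnj (coord x i)))"
    by (simp only: power2_norm_eq_inner inner_ell2_def infsum_Re[OF ell2_mult_summable])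
  then show ?thesis by (simp add: complex_mult_cnj cmod_power2)
qed

context krein_space
begin

lemma index_neg_eq: "index_neg f = - index_pos f"
  by (auto simp: index_neg_def index_pos_def)

lemma form_sgn_index_pos: "form_sgn (f i) = (if i \<in> index_pos f then 1 else - 1)"
  by (simp add: form_sgn_def index_pos_def)

text \<open>The fundamental symmetry of \<open>\<ell>\<^sub>2\<close> with the form \<open>ell2_form f\<close>.\<close>

definition ell2_symmetry :: "('i \<Rightarrow> 'h) \<Rightarrow> 'i ell2 \<Rightarrow> 'i ell2"
  where "ell2_symmetry f x = ell2_proj (index_pos f) x - ell2_proj (index_neg f) x"

lemma coord_ell2_symmetry: "coord (ell2_symmetry f x) i = form_sgn (f i) * coord x i"
  by (simp add: ell2_symmetry_def minus_ell2.rep_eq ell2_proj.rep_eq index_neg_eq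
      form_sgn_index_pos)

lemma ell2_proj_pos_plus_neg: "ell2_proj (index_pos f) x + ell2_proj (index_neg f) x = x"
  by (rule ell2_eqI) (simp add: plus_ell2.rep_eq ell2_proj.rep_eq index_neg_eq)

lemma ell2_symmetry_involution [simp]: "ell2_symmetry f (ell2_symmetry f x) = x"
  by (rule ell2_eqI) (simp add: coord_ell2_symmetry form_sgn_index_pos)

lemma ell2_form_eq_infsum:
  "ell2_form f x y = (\<Sum>\<^sub>\<infinity>i. coord x i * cnj (coord (ell2_symmetry f y) i))"
proof -
  let ?h = "\<lambda>i. coord x i * cnj (coord (ell2_symmetry f y) i)"
  have summ: "?h summable_on A" for A
    using ell2_mult_summable by (rule summable_on_subset_banach) simp
  have "infsum ?h UNIV = infsum ?h (index_pos f \<union> index_neg f)"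
    by (simp add: index_neg_eq)
  also have "\<dots> = infsum ?h (index_pos f) + infsum ?h (index_neg f)"
    by (rule infsum_Un_disjoint[OF summ summ]) (simp add: index_neg_eq)
  also have "infsum ?h (index_pos f) = (\<Sum>\<^sub>\<infinity>i\<in>index_pos f. coord x i * cnj (coord y i))"
    by (rule infsum_cong) (simp add: coord_ell2_symmetry form_sgn_index_pos)
  also have "infsum ?h (index_neg f) = (\<Sum>\<^sub>\<infinity>i\<in>index_neg f. - (coord x i * cnj (coord y i)))"
    by (rule infsum_cong) (simp add: coord_ell2_symmetry form_sgn_index_pos index_neg_eq)
  finally show ?thesis by (simp add: ell2_form_def infsum_uminus)
qed

lemma Re_ell2_form: "Re (ell2_form f x y) = x \<bullet> ell2_symmetry f y"
  by (simp add: ell2_form_eq_infsum inner_ell2_def)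

lemma ell2_form_hermitian: "ell2_form f y x = cnj (ell2_form f x y)"
  by (simp add: ell2_form_def mult.commute flip: infsum_cnj)

end

section \<open>Synthesis and analysis of a Bessel family\<close>

lemma vector_space_ell2: "vector_space ell2_scaleC"
  by unfold_locales
    (auto intro!: ell2_eqI simp: ell2_scaleC.rep_eq plus_ell2.rep_eq algebra_simps)

lemma scaleR_ell2_conv: "r *\<^sub>R x = ell2_scaleC (complex_of_real r) x"
  by (rule ell2_eqI) (simp add: ell2_scaleC.rep_eq scaleR_ell2.rep_eq scaleR_conv_of_real)

context krein_space
begin

lemma bounded_clinearI:
  assumes "\<And>x y. W (x + y) = W x + W y" and "\<And>c x. W (ell2_scaleC c x) = scaleC c (W x)"
    and "\<And>x. norm (W x) \<le> norm x * K"
  shows "bounded_clinear ell2_scaleC scaleC W"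
  unfolding bounded_clinear_def Vector_Spaces.linear_iff
proof (intro conjI allI)
  show "bounded_linear W"
    by (rule bounded_linear_intro[of _ K])
      (simp_all add: assms scaleR_ell2_conv flip: scaleC_of_real)
  show "vector_space scaleC" by (rule vector_space_axioms)
qed (simp_all add: assms vector_space_ell2)

text \<open>The Hilbert space adjoint of the synthesis operator.\<close>

definition analysis :: "('i \<Rightarrow> 'h) \<Rightarrow> 'h \<Rightarrow> 'i ell2"
  where "analysis f h = Abs_ell2 (\<lambda>i. cinner h (f i))"

lemma coord_analysis:
  assumes "bessel_family f"
  shows "coord (analysis f h) i = cinner h (f i)"
  using assms unfolding analysis_def bessel_family_def by (subst Abs_ell2_inverse) auto

lemma analysis_bounded:
  assumes "bessel_family f"
  obtains K where "K > 0" and "\<And>h. norm (analysis f h) \<le> K * norm h"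
proof -
  obtain \<beta> where \<beta>: "\<beta> > 0" "\<And>x. (\<Sum>\<^sub>\<infinity>i. (cmod (cinner x (f i)))\<^sup>2) \<le> \<beta> * (norm x)\<^sup>2"
    using assms unfolding bessel_family_def by blast
  have "norm (analysis f h) \<le> sqrt \<beta> * norm h" for h
  proof (rule power2_le_imp_le)
    show "(norm (analysis f h))\<^sup>2 \<le> (sqrt \<beta> * norm h)\<^sup>2"
      using \<beta> by (simp add: power2_norm_ell2 coord_analysis[OF assms] power_mult_distrib)
  qed (use \<beta>(1) in simp)
  with \<beta>(1) show thesis by (intro that[of "sqrt \<beta>"]) auto
qed

lemma analysis_add:
  "bessel_family f \<Longrightarrow> analysis f (x + y) = analysis f x + analysis f y"
  by (rule ell2_eqI) (simp add: coord_analysis plus_ell2.rep_eq cinner_add_left)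

lemma analysis_scale:
  "bessel_family f \<Longrightarrow> analysis f (scaleC c x) = ell2_scaleC c (analysis f x)"
  by (rule ell2_eqI) (simp add: coord_analysis ell2_scaleC.rep_eq cinner_scale_left)

lemma bounded_linear_analysis:
  assumes "bessel_family f"
  shows "bounded_linear (analysis f)"
proof -
  obtain K where "\<And>h. norm (analysis f h) \<le> K * norm h"
    using analysis_bounded[OF assms] by metis
  then show ?thesis
    by (intro bounded_linear_intro[of _ K])
      (simp_all add: analysis_add[OF assms] analysis_scale[OF assms] scaleR_ell2_conv mult.commute
        flip: scaleC_of_real)
qed

text \<open>A finite sum \<open>s\<close> satisfies \<open>(norm s)\<^sup>2 = (\<Sum>i\<in>F. c i * cinner (f i) s)\<close>, so the
  Cauchy-Schwarz inequality and the Bessel bound for \<open>s\<close> itself control its norm.\<close>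

lemma norm_sum_bessel_le:
  assumes "bessel_family f"
  obtains \<beta> where "\<beta> > 0"
    and "\<And>c F. finite F \<Longrightarrow> (norm (\<Sum>i\<in>F. scaleC (c i) (f i)))\<^sup>2 \<le> \<beta> * (\<Sum>i\<in>F. (cmod (c i))\<^sup>2)"
proof -
  obtain \<beta> where \<beta>: "\<beta> > 0" "\<And>x. (\<lambda>i. (cmod (cinner x (f i)))\<^sup>2) summable_on UNIV"
      "\<And>x. (\<Sum>\<^sub>\<infinity>i. (cmod (cinner x (f i)))\<^sup>2) \<le> \<beta> * (norm x)\<^sup>2"
    using assms unfolding bessel_family_def by blast
  have "(norm (\<Sum>i\<in>F. scaleC (c i) (f i)))\<^sup>2 \<le> \<beta> * (\<Sum>i\<in>F. (cmod (c i))\<^sup>2)"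
    if F: "finite F" for c F
  proof -
    define s where "s = (\<Sum>i\<in>F. scaleC (c i) (f i))"
    define a where "a = (\<Sum>i\<in>F. (cmod (c i))\<^sup>2)"
    have "cinner s s = (\<Sum>i\<in>F. c i * cinner (f i) s)"
      using linear_sum[OF bounded_linear.linear[OF bounded_linear_cinner_left[of s]],
          of "\<lambda>i. scaleC (c i) (f i)" F]
      by (simp add: s_def[symmetric] cinner_scale_left)
    moreover have "(norm s)\<^sup>2 \<le> cmod (cinner s s)"
      unfolding power2_norm_eq_Re_cinner by (rule complex_Re_le_cmod)
    ultimately have "(norm s)\<^sup>2 \<le> cmod (\<Sum>i\<in>F. c i * cinner (f i) s)" by (simp only:)
    also have "\<dots> \<le> (\<Sum>i\<in>F. \<bar>cmod (c i)\<bar> * \<bar>cmod (cinner s (f i))\<bar>)"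
      by (rule order.trans[OF norm_sum])
        (simp add: norm_mult cinner_commute[of s])
    also have "\<dots> \<le> L2_set (\<lambda>i. cmod (c i)) F * L2_set (\<lambda>i. cmod (cinner s (f i))) F"
      by (rule L2_set_mult_ineq)
    also have "\<dots> = sqrt a * sqrt (\<Sum>i\<in>F. (cmod (cinner s (f i)))\<^sup>2)"
      by (simp add: L2_set_def a_def)
    also have "\<dots> \<le> sqrt a * sqrt (\<beta> * (norm s)\<^sup>2)"
    proof -
      have "(\<Sum>i\<in>F. (cmod (cinner s (f i)))\<^sup>2) \<le> (\<Sum>\<^sub>\<infinity>i. (cmod (cinner s (f i)))\<^sup>2)"
        by (rule finite_sum_le_infsum) (use \<beta>(2) F in auto)
      then have "(\<Sum>i\<in>F. (cmod (cinner s (f i)))\<^sup>2) \<le> \<beta> * (norm s)\<^sup>2"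
        using \<beta>(3)[of s] by linarith
      then show ?thesis by (intro mult_left_mono) (simp_all add: a_def sum_nonneg)
    qed
    finally have "norm s * norm s \<le> sqrt (\<beta> * a) * norm s"
      by (simp add: real_sqrt_mult power2_eq_square mult_ac)
    then have "norm s \<le> sqrt (\<beta> * a)"
      using \<beta>(1) by (cases "s = 0") (simp_all add: a_def sum_nonneg)
    then have "(norm s)\<^sup>2 \<le> (sqrt (\<beta> * a))\<^sup>2" by (rule power_mono) simp
    then show ?thesis
      using \<beta>(1) by (simp add: s_def[symmetric] a_def[symmetric]) (simp add: a_def sum_nonneg)
  qed
  with \<beta>(1) that show thesis by blast
qed

lemma synthesis_has_sum:
  assumes "bessel_family f"
  shows "((\<lambda>i. scaleC (coord x i) (f i)) has_sum synthesis f x) UNIV"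
proof -
  obtain \<beta> where \<beta>: "\<beta> > 0"
    "\<And>c F. finite F \<Longrightarrow> (norm (\<Sum>i\<in>F. scaleC (c i) (f i)))\<^sup>2 \<le> \<beta> * (\<Sum>i\<in>F. (cmod (c i))\<^sup>2)"
    using norm_sum_bessel_le[OF assms] by metis
  have "(\<lambda>i. scaleC (coord x i) (f i)) summable_on UNIV"
    by (rule summable_on_if_square_dominated[OF krein_space_complete \<beta>(2)])
      (use coord[of x] \<beta>(1) in auto)
  then show ?thesis unfolding synthesis_def by (rule has_sum_infsum)
qed

lemma synthesis_add:
  assumes "bessel_family f"
  shows "synthesis f (x + y) = synthesis f x + synthesis f y"
proof -
  have "((\<lambda>i. scaleC (coord (x + y) i) (f i)) has_sum (synthesis f x + synthesis f y)) UNIV"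
    using has_sum_add[OF synthesis_has_sum[OF assms, of x] synthesis_has_sum[OF assms, of y]]
    by (simp add: plus_ell2.rep_eq scale_left_distrib)
  then show ?thesis unfolding synthesis_def[of f "x + y"] by (rule infsumI)
qed

lemma synthesis_scale:
  assumes "bessel_family f"
  shows "synthesis f (ell2_scaleC c x) = scaleC c (synthesis f x)"
proof -
  have "((\<lambda>i. scaleC (coord (ell2_scaleC c x) i) (f i)) has_sum scaleC c (synthesis f x)) UNIV"
    using has_sum_bounded_linear[OF bounded_linear_scaleC[of c] synthesis_has_sum[OF assms, of x]]
    by (simp add: ell2_scaleC.rep_eq)
  then show ?thesis unfolding synthesis_def[of f "ell2_scaleC c x"] by (rule infsumI)
qed

lemma cinner_synthesis:
  assumes "bessel_family f"
  shows "cinner (synthesis f x) h = (\<Sum>\<^sub>\<infinity>i. coord x i * cnj (coord (analysis f h) i))"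
proof -
  have "((\<lambda>i. cinner (scaleC (coord x i) (f i)) h) has_sum cinner (synthesis f x) h) UNIV"
    by (rule has_sum_bounded_linear[OF bounded_linear_cinner_left synthesis_has_sum[OF assms]])
  moreover have "cinner (scaleC (coord x i) (f i)) h
      = coord x i * cnj (coord (analysis f h) i)" for i
    using cinner_commute[of "f i" h] by (simp add: cinner_scale_left coord_analysis[OF assms])
  ultimately have
    "((\<lambda>i. coord x i * cnj (coord (analysis f h) i)) has_sum cinner (synthesis f x) h) UNIV"
    by simp
  then show ?thesis by (rule infsumI[symmetric])
qed

lemma inner_synthesis: "bessel_family f \<Longrightarrow> synthesis f x \<bullet> h = x \<bullet> analysis f h"
  by (simp add: inner_eq_Re_cinner cinner_synthesis inner_ell2_def)

lemma synthesis_bounded: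
  assumes "bessel_family f"
  obtains K where "K > 0" and "\<And>x. norm (synthesis f x) \<le> norm x * K"
proof -
  obtain K where K: "K > 0" "\<And>h. norm (analysis f h) \<le> K * norm h"
    using analysis_bounded[OF assms] by metis
  have "norm (synthesis f x) \<le> norm x * K" for x
  proof (cases "synthesis f x = 0")
    case False
    have "norm (synthesis f x) * norm (synthesis f x) = x \<bullet> analysis f (synthesis f x)"
      by (simp add: inner_synthesis[OF assms, symmetric] power2_norm_eq_inner[symmetric]
          power2_eq_square[symmetric])
    also have "\<dots> \<le> norm x * norm (analysis f (synthesis f x))" by (rule norm_cauchy_schwarz)
    also have "\<dots> \<le> norm x * (K * norm (synthesis f x))" by (intro mult_left_mono K) simp
    finally have "norm (synthesis f x) * norm (synthesis f x)
        \<le> (norm x * K) * norm (synthesis f x)" by (simp add: mult.assoc)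
    then show ?thesis using False by simp
  qed (use K(1) in simp)
  with K(1) that show thesis by blast
qed

lemma bounded_clinear_synthesis:
  assumes "bessel_family f"
  shows "bounded_clinear ell2_scaleC scaleC (synthesis f)"
proof -
  obtain K where "\<And>x. norm (synthesis f x) \<le> norm x * K"
    using synthesis_bounded[OF assms] by metis
  then show ?thesis
    by (rule bounded_clinearI[OF synthesis_add[OF assms] synthesis_scale[OF assms]])
qed

lemma bounded_linear_synthesis: "bessel_family f \<Longrightarrow> bounded_linear (synthesis f)"
  using bounded_clinear_synthesis by (auto simp: bounded_clinear_def)

section \<open>Adjoints with respect to the indefinite forms\<close>

text \<open>The adjoint of the synthesis operator of \<open>g\<close>, for the form on \<open>\<ell>\<^sub>2\<close> whose signs are those
  of \<open>f\<close>.\<close>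

definition J_adjoint :: "('i \<Rightarrow> 'h) \<Rightarrow> ('i \<Rightarrow> 'h) \<Rightarrow> 'h \<Rightarrow> 'i ell2"
  where "J_adjoint f g y = ell2_symmetry f (analysis g (fundamental_symmetry y))"

lemma coord_J_adjoint:
  "bessel_family g \<Longrightarrow> coord (J_adjoint f g y) i = form_sgn (f i) * form y (g i)"
  by (simp add: J_adjoint_def coord_ell2_symmetry coord_analysis cinner_fundamental_symmetry_left)

lemma form_synthesis:
  "bessel_family g \<Longrightarrow> form (synthesis g x) y = ell2_form f x (J_adjoint f g y)"
  using cinner_synthesis[of g x "fundamental_symmetry y"]
  by (simp add: ell2_form_eq_infsum J_adjoint_def cinner_fundamental_symmetry_right)

lemma ell2_form_nondegenerate:
  assumes "\<And>x. Re (ell2_form f x a) = Re (ell2_form f x b)"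
  shows "a = b"
proof -
  let ?d = "ell2_symmetry f a - ell2_symmetry f b"
  have "?d \<bullet> ?d = 0"
    using assms[of ?d] by (simp add: Re_ell2_form inner_diff_right)
  then have "ell2_symmetry f a = ell2_symmetry f b" by simp
  then show ?thesis by (metis ell2_symmetry_involution)
qed

lemma krein_adjoint_synthesis:
  assumes "bessel_family g"
  shows "krein_adjoint (ell2_form f) form (synthesis g) = J_adjoint f g"
  unfolding krein_adjoint_def
proof (rule the_equality)
  show "\<forall>x y. form (synthesis g x) y = ell2_form f x (J_adjoint f g y)"
    using form_synthesis[OF assms] by blast
next
  fix A assume "\<forall>x y. form (synthesis g x) y = ell2_form f x (A y)"
  then have "ell2_form f x (A y) = ell2_form f x (J_adjoint f g y)" for x y
    using form_synthesis[OF assms, of x y f] by metis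
  then show "A = J_adjoint f g"
    by (intro ext ell2_form_nondegenerate[of f]) simp
qed

lemma form_eqI:
  assumes "\<And>x. form x a = form x b"
  shows "a = b"
  using form_nondegenerate[of "a - b"] assms by (simp add: form_diff_right)

text \<open>With \<open>T = synthesis f\<close> and \<open>V = synthesis g\<close>, the operators \<open>V T\<^sup>+\<close> and \<open>T V\<^sup>+\<close> are adjoint to each other, so the two reconstruction
  formulas of a dual family are equivalent.\<close>

lemma reconstruction_swap:
  assumes "bessel_family f" and "bessel_family g"
    and "\<And>x. synthesis g (J_adjoint f f x) = x"
  shows "synthesis f (J_adjoint f g y) = y"
proof (rule form_eqI)
  fix x
  have "form (synthesis f (J_adjoint f g y)) x = ell2_form f (J_adjoint f g y) (J_adjoint f f x)"
    by (rule form_synthesis[OF assms(1)])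
  also have "\<dots> = cnj (ell2_form f (J_adjoint f f x) (J_adjoint f g y))"
    by (rule ell2_form_hermitian)
  also have "\<dots> = cnj (form (synthesis g (J_adjoint f f x)) y)"
    by (simp only: form_synthesis[OF assms(2), of _ _ f])
  also have "\<dots> = cnj (form x y)" by (simp only: assms(3))
  finally show "form x (synthesis f (J_adjoint f g y)) = form x y"
    using form_hermitian[of x "synthesis f (J_adjoint f g y)"] by simp
qed

lemma dual_family_iff:
  assumes f: "bessel_family f" and g: "bessel_family g"
    and signs: "\<forall>i. form_sgn (f i) = form_sgn (g i)"
  shows "dual_family f g \<longleftrightarrow> (\<forall>x. synthesis g (J_adjoint f f x) = x)"
proof -
  have sums: "((\<lambda>i. scaleC (complex_of_real (form_sgn (f i)) * form x (h i)) (k i)) has_sum s) UNIV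
      \<longleftrightarrow> synthesis k (J_adjoint f h x) = s"
    if h: "bessel_family h" and k: "bessel_family k" for h k x s
    using synthesis_has_sum[OF k, of "J_adjoint f h x"] has_sum_unique
    by (auto simp: coord_J_adjoint[OF h])
  show ?thesis
    unfolding dual_family_def sums[OF f g] sums[OF g f]
    using signs g reconstruction_swap[OF f g] by blast
qed

end

section \<open>Maximal uniformly definite subspaces\<close>

context krein_space
begin

text \<open>Both signs at once: \<open>\<sigma> = 1\<close> gives the uniformly positive and \<open>\<sigma> = -1\<close> the uniformly
  negative subspaces.\<close>

definition uniformly_definite :: "real \<Rightarrow> 'h set \<Rightarrow> bool"
  where "uniformly_definite \<sigma> A \<longleftrightarrow> subspace A \<and>
    (\<exists>\<alpha>>0. \<forall>x\<in>A. \<alpha> * (norm x)\<^sup>2 \<le> \<sigma> * Re (form x x))"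

definition maximal_uniformly_definite :: "real \<Rightarrow> 'h set \<Rightarrow> bool"
  where "maximal_uniformly_definite \<sigma> A \<longleftrightarrow> uniformly_definite \<sigma> A \<and>
    (\<forall>B. uniformly_definite \<sigma> B \<and> A \<subseteq> B \<longrightarrow> B = A)"

lemma maximal_uniformly_J_positive_iff:
  "maximal_uniformly_J_positive A \<longleftrightarrow> maximal_uniformly_definite 1 A"
  by (simp add: maximal_uniformly_J_positive_def maximal_uniformly_definite_def
      uniformly_J_positive_def uniformly_definite_def)

lemma maximal_uniformly_J_negative_iff:
  "maximal_uniformly_J_negative A \<longleftrightarrow> maximal_uniformly_definite (- 1) A"
  by (simp add: maximal_uniformly_J_negative_def maximal_uniformly_definite_def
      uniformly_J_negative_def uniformly_definite_def)

lemma subspace_closure_scaleC: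
  assumes A: "subspace A"
  shows "subspace (closure A)"
proof (rule subspaceI)
  show "0 \<in> closure A" using subspace_0[OF A] closure_subset by blast
next
  fix x y assume "x \<in> closure A" "y \<in> closure A"
  then obtain X Y where XY: "\<And>n. X n \<in> A" "X \<longlonglongrightarrow> x" "\<And>n. Y n \<in> A" "Y \<longlonglongrightarrow> y"
    unfolding closure_sequential by metis
  have "(\<lambda>n. X n + Y n) \<longlonglongrightarrow> x + y" by (intro tendsto_add XY)
  moreover have "X n + Y n \<in> A" for n by (intro subspace_add A XY)
  ultimately show "x + y \<in> closure A" unfolding closure_sequential by metis
next
  fix c x assume "x \<in> closure A"
  then obtain X where X: "\<And>n. X n \<in> A" "X \<longlonglongrightarrow> x"
    unfolding closure_sequential by metis
  have "(\<lambda>n. scaleC c (X n)) \<longlonglongrightarrow> scaleC c x"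
    by (rule bounded_linear.tendsto[OF bounded_linear_scaleC X(2)])
  moreover have "scaleC c (X n) \<in> A" for n by (intro subspace_scale A X)
  ultimately show "scaleC c x \<in> closure A" unfolding closure_sequential by metis
qed

text \<open>The defining inequality passes to limits, so maximality absorbs the closure.\<close>

lemma maximal_uniformly_definite_closed:
  assumes "maximal_uniformly_definite \<sigma> A"
  shows "closed A"
proof -
  obtain \<alpha> where A: "subspace A" and \<alpha>: "\<alpha> > 0" "\<And>x. x \<in> A \<Longrightarrow> \<alpha> * (norm x)\<^sup>2 \<le> \<sigma> * Re (form x x)"
    using assms unfolding maximal_uniformly_definite_def uniformly_definite_def by blast
  have "\<alpha> * (norm x)\<^sup>2 \<le> \<sigma> * Re (form x x)" if "x \<in> closure A" for x
  proof -
    obtain X where X: "\<And>n. X n \<in> A" "X \<longlonglongrightarrow> x"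
      using \<open>x \<in> closure A\<close> unfolding closure_sequential by metis
    have "(\<lambda>n. \<sigma> * (X n \<bullet> fundamental_symmetry (X n))) \<longlonglongrightarrow> \<sigma> * (x \<bullet> fundamental_symmetry x)"
      by (intro tendsto_intros X bounded_linear.tendsto[OF bounded_linear_fundamental_symmetry])
    moreover have "(\<lambda>n. \<alpha> * (norm (X n))\<^sup>2) \<longlonglongrightarrow> \<alpha> * (norm x)\<^sup>2"
      by (intro tendsto_intros X)
    moreover have "\<alpha> * (norm (X n))\<^sup>2 \<le> \<sigma> * (X n \<bullet> fundamental_symmetry (X n))" for n
      using \<alpha>(2)[OF X(1)] by (simp add: Re_form_eq_inner)
    ultimately have "\<alpha> * (norm x)\<^sup>2 \<le> \<sigma> * (x \<bullet> fundamental_symmetry x)"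
      by (intro LIMSEQ_le) auto
    then show ?thesis by (simp add: Re_form_eq_inner)
  qed
  then have "uniformly_definite \<sigma> (closure A)"
    using \<alpha>(1) subspace_closure_scaleC[OF A] unfolding uniformly_definite_def by blast
  then have "closure A = A"
    using assms closure_subset unfolding maximal_uniformly_definite_def by blast
  then show ?thesis by (simp add: closure_eq)
qed

text \<open>If \<open>\<sigma> * Re (form z z)\<close> were positive, adding the line spanned by \<open>z\<close> would give a larger
  uniformly definite subspace.\<close>

lemma maximal_uniformly_definite_orthogonal:
  assumes max: "maximal_uniformly_definite \<sigma> A" and orth: "\<And>a. a \<in> A \<Longrightarrow> form z a = 0"
  shows "\<sigma> * Re (form z z) \<le> 0"
proof (rule ccontr)
  assume "\<not> ?thesis"
  then have zpos: "\<sigma> * Re (form z z) > 0" by simp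
  then have z: "z \<noteq> 0" by auto
  obtain \<alpha> where A: "subspace A" and \<alpha>: "\<alpha> > 0" "\<And>x. x \<in> A \<Longrightarrow> \<alpha> * (norm x)\<^sup>2 \<le> \<sigma> * Re (form x x)"
    using max unfolding maximal_uniformly_definite_def uniformly_definite_def by blast
  define \<gamma> where "\<gamma> = \<sigma> * Re (form z z) / (norm z)\<^sup>2"
  have \<gamma>: "\<gamma> > 0" "\<sigma> * Re (form z z) = \<gamma> * (norm z)\<^sup>2" using zpos z by (auto simp: \<gamma>_def)
  define B where "B = {a + scaleC c z |a c. a \<in> A}"
  have AB: "A \<subseteq> B"
  proof
    fix a assume "a \<in> A"
    then have "a + scaleC 0 z \<in> B" unfolding B_def by blast
    then show "a \<in> B" by simp
  qed
  have "subspace B"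
  proof (rule subspaceI)
    show "0 \<in> B" using AB subspace_0[OF A] by blast
  next
    fix x y assume "x \<in> B" "y \<in> B"
    then obtain a c a' c' where *: "a \<in> A" "a' \<in> A" "x = a + scaleC c z" "y = a' + scaleC c' z"
      unfolding B_def by blast
    have "x + y = (a + a') + scaleC (c + c') z" by (simp add: * scale_left_distrib)
    then show "x + y \<in> B" unfolding B_def using subspace_add[OF A *(1,2)] by blast
  next
    fix c x assume "x \<in> B"
    then obtain a d where *: "a \<in> A" "x = a + scaleC d z" unfolding B_def by blast
    have "scaleC c x = scaleC c a + scaleC (c * d) z" by (simp add: * scale_right_distrib)
    then show "scaleC c x \<in> B" unfolding B_def using subspace_scale[OF A *(1)] by blast
  qed
  moreover have "min \<alpha> \<gamma> / 2 * (norm x)\<^sup>2 \<le> \<sigma> * Re (form x x)" if "x \<in> B" for x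
  proof -
    obtain a c where x: "a \<in> A" "x = a + scaleC c z" using \<open>x \<in> B\<close> unfolding B_def by blast
    let ?w = "scaleC c z"
    have "form a z = 0" using form_hermitian[of a z] orth[OF x(1)] by simp
    then have "form x x = form a a + form ?w ?w"
      using orth[OF x(1)]
      by (simp add: x(2) form_add_left form_add_right form_scale_left form_scale_right)
    moreover have "form ?w ?w = complex_of_real ((cmod c)\<^sup>2) * form z z"
      by (simp only: form_scale_left form_scale_right complex_norm_square mult_ac)
    ultimately have "\<sigma> * Re (form x x) = \<sigma> * Re (form a a) + (cmod c)\<^sup>2 * (\<sigma> * Re (form z z))"
      by (simp add: algebra_simps)
    also have "\<dots> = \<sigma> * Re (form a a) + \<gamma> * (norm ?w)\<^sup>2"
      by (simp add: \<gamma>(2) norm_scaleC power_mult_distrib)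
    finally have eq: "\<sigma> * Re (form x x) = \<sigma> * Re (form a a) + \<gamma> * (norm ?w)\<^sup>2" .
    have "(norm x)\<^sup>2 \<le> (norm a + norm ?w)\<^sup>2"
      unfolding x(2) by (intro power_mono norm_triangle_ineq) simp
    also have "\<dots> \<le> 2 * (norm a)\<^sup>2 + 2 * (norm ?w)\<^sup>2"
      using sum_squares_bound[of "norm a" "norm ?w"] by (simp add: power2_sum)
    finally have "min \<alpha> \<gamma> / 2 * (norm x)\<^sup>2 \<le> min \<alpha> \<gamma> / 2 * (2 * (norm a)\<^sup>2 + 2 * (norm ?w)\<^sup>2)"
      using \<alpha>(1) \<gamma>(1) by (intro mult_left_mono) auto
    also have "\<dots> = min \<alpha> \<gamma> * (norm a)\<^sup>2 + min \<alpha> \<gamma> * (norm ?w)\<^sup>2" by (simp add: algebra_simps)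
    also have "\<dots> \<le> \<alpha> * (norm a)\<^sup>2 + \<gamma> * (norm ?w)\<^sup>2"
      by (intro add_mono mult_right_mono) auto
    also have "\<dots> \<le> \<sigma> * Re (form x x)" unfolding eq using \<alpha>(2)[OF x(1)] by simp
    finally show ?thesis .
  qed
  ultimately have "uniformly_definite \<sigma> B"
    unfolding uniformly_definite_def using \<alpha>(1) \<gamma>(1)
    by (intro conjI exI[of _ "min \<alpha> \<gamma> / 2"]) auto
  then have "B = A" using max AB unfolding maximal_uniformly_definite_def by blast
  moreover have "0 + scaleC 1 z \<in> B" unfolding B_def using subspace_0[OF A] by blast
  then have "z \<in> B" by simp
  ultimately have "form z z = 0" using orth by blast
  with zpos show False by simp
qed

text \<open>The mixed terms cancel: \<open>Re [u + v, u - v] = [u, u] - [v, v]\<close>.\<close>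

lemma definite_pair_coercive:
  assumes "uniformly_definite 1 A" and "uniformly_definite (- 1) B"
  obtains m where "m > 0"
    and "\<And>u v. u \<in> A \<Longrightarrow> v \<in> B \<Longrightarrow> m * ((norm u)\<^sup>2 + (norm v)\<^sup>2) \<le> Re (form (u + v) (u - v))"
proof -
  obtain \<alpha> where \<alpha>: "\<alpha> > 0" "\<And>x. x \<in> A \<Longrightarrow> \<alpha> * (norm x)\<^sup>2 \<le> Re (form x x)"
    using assms(1) unfolding uniformly_definite_def by auto
  obtain \<beta> where \<beta>: "\<beta> > 0" "\<And>x. x \<in> B \<Longrightarrow> \<beta> * (norm x)\<^sup>2 \<le> - Re (form x x)"
    using assms(2) unfolding uniformly_definite_def by auto
  have "min \<alpha> \<beta> * ((norm u)\<^sup>2 + (norm v)\<^sup>2) \<le> Re (form (u + v) (u - v))"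
    if uv: "u \<in> A" "v \<in> B" for u v
  proof -
    have "min \<alpha> \<beta> * ((norm u)\<^sup>2 + (norm v)\<^sup>2) = min \<alpha> \<beta> * (norm u)\<^sup>2 + min \<alpha> \<beta> * (norm v)\<^sup>2"
      by (simp add: algebra_simps)
    also have "\<dots> \<le> \<alpha> * (norm u)\<^sup>2 + \<beta> * (norm v)\<^sup>2"
      by (intro add_mono mult_right_mono) auto
    also have "\<dots> \<le> Re (form u u) - Re (form v v)" using \<alpha>(2)[OF uv(1)] \<beta>(2)[OF uv(2)] by linarith
    also have "\<dots> = Re (form (u + v) (u - v))"
      using Re_form_commute[of u v] by (simp add: form_add_left form_diff_right)
    finally show ?thesis .
  qed
  moreover have "min \<alpha> \<beta> > 0" using \<alpha>(1) \<beta>(1) by simp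
  ultimately show thesis using that by blast
qed

text \<open>The right-hand side of the coercivity estimate is at most \<open>norm (u + v) * norm (u - v)\<close>.  The
  result says that the sum of the two subspaces is topologically direct.\<close>

lemma definite_pair_norm_le:
  assumes "uniformly_definite 1 A" and "uniformly_definite (- 1) B"
  obtains C where "C > 0" and "\<And>u v. u \<in> A \<Longrightarrow> v \<in> B \<Longrightarrow> norm (u - v) \<le> C * norm (u + v)"
proof -
  obtain m where m: "m > 0"
    "\<And>u v. u \<in> A \<Longrightarrow> v \<in> B \<Longrightarrow> m * ((norm u)\<^sup>2 + (norm v)\<^sup>2) \<le> Re (form (u + v) (u - v))"
    using definite_pair_coercive[OF assms] by metis
  have "norm (u - v) \<le> 2 / m * norm (u + v)" if uv: "u \<in> A" "v \<in> B" for u v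
  proof (cases "u = v")
    case False
    have "(norm (u - v))\<^sup>2 \<le> (norm u + norm v)\<^sup>2"
      by (intro power_mono norm_triangle_ineq4) simp
    also have "\<dots> \<le> 2 * ((norm u)\<^sup>2 + (norm v)\<^sup>2)"
      using sum_squares_bound[of "norm u" "norm v"] by (simp add: power2_sum)
    finally have "m * (norm (u - v))\<^sup>2 \<le> 2 * (m * ((norm u)\<^sup>2 + (norm v)\<^sup>2))"
      using m(1) by simp
    also have "m * ((norm u)\<^sup>2 + (norm v)\<^sup>2) \<le> cmod (form (u + v) (u - v))"
      using m(2)[OF uv] complex_Re_le_cmod[of "form (u + v) (u - v)"] by linarith
    also have "\<dots> \<le> norm (u + v) * norm (u - v)" by (rule norm_form_le)
    finally have "(m * norm (u - v)) * norm (u - v) \<le> (2 * norm (u + v)) * norm (u - v)"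
      by (simp add: power2_eq_square mult.assoc)
    then have "m * norm (u - v) \<le> 2 * norm (u + v)" using False by simp
    then show ?thesis using m(1) by (simp add: field_simps)
  qed (use m(1) in simp)
  moreover have "2 / m > 0" using m(1) by simp
  ultimately show thesis using that by blast
qed

text \<open>By \<open>definite_pair_norm_le\<close>, the sequence \<open>u n - v n\<close> is Cauchy whenever \<open>u n + v n\<close> is, so the two
  components converge separately.\<close>

lemma definite_pair_sum_complete:
  assumes A: "uniformly_definite 1 A" "closed A" and B: "uniformly_definite (- 1) B" "closed B"
  shows "complete {u + v |u v. u \<in> A \<and> v \<in> B}"
  unfolding complete_def
proof (intro allI impI)
  fix X assume X: "(\<forall>n. X n \<in> {u + v |u v. u \<in> A \<and> v \<in> B}) \<and> Cauchy X"
  then have "\<forall>n. \<exists>u v. X n = u + v \<and> u \<in> A \<and> v \<in> B" by blast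
  then obtain u v where uv: "\<And>n. X n = u n + v n" "\<And>n. u n \<in> A" "\<And>n. v n \<in> B" by metis
  have sub: "subspace A" "subspace B" using A(1) B(1) by (auto simp: uniformly_definite_def)
  obtain C where C: "C > 0" "\<And>u v. u \<in> A \<Longrightarrow> v \<in> B \<Longrightarrow> norm (u - v) \<le> C * norm (u + v)"
    using definite_pair_norm_le[OF A(1) B(1)] by metis
  define Y where "Y n = u n - v n" for n
  have "Cauchy Y"
  proof (rule metric_CauchyI)
    fix e :: real assume "e > 0"
    then have "e / C > 0" using C(1) by simp
    then obtain N where N: "\<And>m n. m \<ge> N \<Longrightarrow> n \<ge> N \<Longrightarrow> dist (X m) (X n) < e / C"
      using X metric_CauchyD[of X "e / C"] by metis
    have "dist (Y m) (Y n) < e" if "m \<ge> N" "n \<ge> N" for m n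
    proof -
      have eqs: "Y m - Y n = (u m - u n) - (v m - v n)" "X m - X n = (u m - u n) + (v m - v n)"
        by (simp_all add: Y_def uv(1))
      have "u m - u n \<in> A" "v m - v n \<in> B"
        using subspace_diff[OF sub(1) uv(2) uv(2)] subspace_diff[OF sub(2) uv(3) uv(3)] by auto
      from C(2)[OF this] have "dist (Y m) (Y n) \<le> C * dist (X m) (X n)"
        by (simp only: dist_norm eqs)
      also have "\<dots> < C * (e / C)" using N[OF that] C(1) by (rule mult_strict_left_mono)
      finally show ?thesis using C(1) by simp
    qed
    then show "\<exists>N. \<forall>m\<ge>N. \<forall>n\<ge>N. dist (Y m) (Y n) < e" by blast
  qed
  then obtain y where y: "Y \<longlonglongrightarrow> y"
    using completeE[OF krein_space_complete, of Y] by auto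
  obtain x where x: "X \<longlonglongrightarrow> x"
    using X completeE[OF krein_space_complete, of X] by auto
  have "(\<lambda>n. (1/2) *\<^sub>R (X n + Y n)) \<longlonglongrightarrow> (1/2) *\<^sub>R (x + y)"
    by (intro tendsto_intros x y)
  moreover have "(1/2) *\<^sub>R (X n + Y n) = u n" for n
    by (simp add: uv(1) Y_def flip: scaleR_2)
  ultimately have "u \<longlonglongrightarrow> (1/2) *\<^sub>R (x + y)" by simp
  with A(2) uv(2) have inA: "(1/2) *\<^sub>R (x + y) \<in> A" by (rule closed_sequentially)
  have "(\<lambda>n. (1/2) *\<^sub>R (X n - Y n)) \<longlonglongrightarrow> (1/2) *\<^sub>R (x - y)"
    by (intro tendsto_intros x y)
  moreover have "(1/2) *\<^sub>R (X n - Y n) = v n" for n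
    by (simp add: uv(1) Y_def flip: scaleR_2)
  ultimately have "v \<longlonglongrightarrow> (1/2) *\<^sub>R (x - y)" by simp
  with B(2) uv(3) have inB: "(1/2) *\<^sub>R (x - y) \<in> B" by (rule closed_sequentially)
  have "x = (1/2) *\<^sub>R (x + y) + (1/2) *\<^sub>R (x - y)"
    by (simp add: scaleR_add_right scaleR_diff_right flip: scaleR_add_left)
  with inA inB x show "\<exists>l\<in>{u + v |u v. u \<in> A \<and> v \<in> B}. X \<longlonglongrightarrow> l" by blast
qed

text \<open>Let \<open>D = A + B\<close> and let \<open>N\<close> be its Hilbert space orthogonal complement, so that \<open>J N\<close> is
  its orthogonal companion.  By maximality no vector of \<open>J N\<close> is positive or negative, hence the
  form vanishes on \<open>N\<close>.  So \<open>J\<close> maps \<open>N\<close> into \<open>D\<close>, and a vector \<open>u + v\<close> of \<open>D\<close> orthogonal to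
  \<open>u - v\<close> is zero.\<close>

lemma maximal_pair_sum_UNIV:
  assumes maxA: "maximal_uniformly_definite 1 A" and maxB: "maximal_uniformly_definite (- 1) B"
  obtains u v where "u \<in> A" and "v \<in> B" and "h = u + v"
proof -
  define D where "D = {u + v |u v. u \<in> A \<and> v \<in> B}"
  have A: "uniformly_definite 1 A" "closed A" and B: "uniformly_definite (- 1) B" "closed B"
    using maxA maxB maximal_uniformly_definite_closed
    by (auto simp: maximal_uniformly_definite_def)
  have sub: "subspace A" "subspace B" using A(1) B(1) by (auto simp: uniformly_definite_def)
  have D: "subspace D" unfolding D_def by (rule subspace_sums[OF sub])
  have complD: "complete D" unfolding D_def by (rule definite_pair_sum_complete[OF A B])
  have realD: "Real_Vector_Spaces.subspace D"
    unfolding Real_Vector_Spaces.subspace_def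
    using subspace_0[OF D] subspace_add[OF D] subspace_scale[OF D]
    by (simp flip: scaleC_of_real)
  have AD: "A \<subseteq> D" and BD: "B \<subseteq> D"
    unfolding D_def using subspace_0[OF sub(1)] subspace_0[OF sub(2)]
    by (force, force)
  define N where "N = {w. \<forall>x\<in>D. cinner w x = 0}"
  have proj: "\<exists>d\<in>D. x - d \<in> N" for x
  proof -
    obtain d where d: "d \<in> D" "\<And>e. e \<in> D \<Longrightarrow> (x - d) \<bullet> e = 0"
      using orthogonal_projection_exists[OF realD complD] by metis
    have "cinner (x - d) e = 0" if "e \<in> D" for e
    proof (rule complex_eqI)
      show "Re (cinner (x - d) e) = Re 0" using d(2)[OF that] by (simp add: inner_eq_Re_cinner)
      have "(x - d) \<bullet> scaleC \<i> e = 0" by (rule d(2)[OF subspace_scale[OF D that]])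
      then show "Im (cinner (x - d) e) = Im 0"
        by (simp add: inner_eq_Re_cinner cinner_scale_right)
    qed
    with d(1) show ?thesis unfolding N_def by blast
  qed
  have neutral: "Re (form w w) = 0" if w: "w \<in> N" for w
  proof -
    let ?z = "fundamental_symmetry w"
    have orth: "form ?z x = 0" if "x \<in> D" for x
      using w that by (simp add: N_def form_fundamental_symmetry_left)
    have "1 * Re (form ?z ?z) \<le> 0"
      by (rule maximal_uniformly_definite_orthogonal[OF maxA]) (use orth AD in blast)
    moreover have "- 1 * Re (form ?z ?z) \<le> 0"
      by (rule maximal_uniformly_definite_orthogonal[OF maxB]) (use orth BD in blast)
    moreover have "form ?z ?z = form w w"
      by (simp only: form_fundamental_symmetry_left cinner_fundamental_symmetry_right)
    ultimately show ?thesis by simp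
  qed
  have isotropic: "Re (form w w') = 0" if "w \<in> N" "w' \<in> N" for w w'
  proof -
    have "w + w' \<in> N" using that by (simp add: N_def cinner_add_left)
    from neutral[OF this] show ?thesis
      using neutral[OF that(1)] neutral[OF that(2)] Re_form_commute[of w w']
      by (simp add: form_add_left form_add_right)
  qed
  have N0: "e = 0" if e: "e \<in> N" for e
  proof -
    let ?z = "fundamental_symmetry e"
    obtain d where d: "d \<in> D" "?z - d \<in> N" using proj by blast
    let ?n = "?z - d"
    have "?n \<bullet> ?z = 0" using isotropic[OF d(2) e] by (simp add: Re_form_eq_inner)
    moreover have "?n \<bullet> d = 0" using d by (simp add: N_def inner_eq_Re_cinner)
    ultimately have "?n \<bullet> ?n = 0" by (simp add: inner_diff_right)
    then have "?z \<in> D" using d(1) by simp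
    then obtain u v where uv: "u \<in> A" "v \<in> B" "?z = u + v" unfolding D_def by blast
    obtain m where m: "m > 0"
      "\<And>u v. u \<in> A \<Longrightarrow> v \<in> B \<Longrightarrow> m * ((norm u)\<^sup>2 + (norm v)\<^sup>2) \<le> Re (form (u + v) (u - v))"
      using definite_pair_coercive[OF A(1) B(1)] by metis
    have "u - v \<in> D" using AD BD uv subspace_diff[OF D] by blast
    then have "form (u + v) (u - v) = 0"
      using e by (simp add: N_def form_fundamental_symmetry_left flip: uv(3))
    with m(2)[OF uv(1,2)] m(1) have "(norm u)\<^sup>2 + (norm v)\<^sup>2 \<le> 0"
      by (simp add: mult_le_0_iff)
    then have "u = 0" "v = 0"
      using sum_power2_le_zero_iff[of "norm u" "norm v"] by auto
    with uv(3) have "norm ?z = 0" by simp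
    then show "e = 0" unfolding norm_fundamental_symmetry by simp
  qed
  obtain d where "d \<in> D" "h - d \<in> N" using proj by blast
  with N0[of "h - d"] have "h \<in> D" by simp
  with that show thesis unfolding D_def by blast
qed

end

section \<open>The J-frame operator is invertible\<close>

context krein_space
begin

lemma J_frame_bessel: "J_frame f \<Longrightarrow> bessel_family f"
  by (simp add: J_frame_def)

lemma J_frame_maximal:
  assumes "J_frame f"
  shows "maximal_uniformly_definite 1 (range (synthesis f \<circ> ell2_proj (index_pos f)))"
    and "maximal_uniformly_definite (- 1) (range (synthesis f \<circ> ell2_proj (index_neg f)))"
  using assms unfolding J_frame_def maximal_uniformly_J_positive_iff maximal_uniformly_J_negative_iff
  by blast+

lemma J_frame_synthesis_surj:
  assumes "J_frame f"
  obtains x where "h = synthesis f x"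
proof -
  obtain u v where "u \<in> range (synthesis f \<circ> ell2_proj (index_pos f))"
    "v \<in> range (synthesis f \<circ> ell2_proj (index_neg f))" and h: "h = u + v"
    using maximal_pair_sum_UNIV[OF J_frame_maximal[OF assms]] by metis
  then obtain a b where "u = synthesis f (ell2_proj (index_pos f) a)"
    "v = synthesis f (ell2_proj (index_neg f) b)" by auto
  with h have "h = synthesis f (ell2_proj (index_pos f) a + ell2_proj (index_neg f) b)"
    by (simp add: synthesis_add[OF J_frame_bessel[OF assms]])
  then show thesis by (rule that)
qed

text \<open>The normalised vectors \<open>y / norm (analysis f y)\<close> are weakly bounded: the inner product of
  such a vector with \<open>h = synthesis f x\<close> is at most \<open>norm x\<close>.  Hence they are bounded.\<close>

lemma synthesis_surj_imp_lower_frame_bound: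
  assumes f: "bessel_family f" and surj: "\<And>h. \<exists>x. h = synthesis f x"
  obtains c where "c > 0" and "\<And>y. c * norm y \<le> norm (analysis f y)"
proof -
  have inj: "y = 0" if "analysis f y = 0" for y
  proof -
    obtain x where "y = synthesis f x" using surj by blast
    then have "y \<bullet> y = x \<bullet> analysis f y" by (simp add: inner_synthesis[OF f])
    with that show ?thesis by simp
  qed
  define A where "A = {(1 / norm (analysis f y)) *\<^sub>R y |y. y \<noteq> 0}"
  have "\<exists>K. \<forall>z\<in>A. \<bar>h \<bullet> z\<bar> \<le> K" for h
  proof -
    obtain x where h: "h = synthesis f x" using surj by blast
    have "\<bar>h \<bullet> ((1 / norm (analysis f y)) *\<^sub>R y)\<bar> \<le> norm x" if "y \<noteq> 0" for y
    proof -
      have pos: "norm (analysis f y) > 0" using inj that by auto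
      have "\<bar>h \<bullet> y\<bar> \<le> norm x * norm (analysis f y)"
        unfolding h inner_synthesis[OF f] by (rule Cauchy_Schwarz_ineq2)
      then show ?thesis using pos by (simp add: abs_mult field_simps)
    qed
    then show ?thesis unfolding A_def by blast
  qed
  then obtain C where C: "\<And>z. z \<in> A \<Longrightarrow> norm z \<le> C"
    using weakly_bounded_imp_bounded[OF krein_space_complete, of A] by blast
  define C' where "C' = max C 1"
  have C': "C' > 0" "C \<le> C'" by (auto simp: C'_def)
  have "1 / C' * norm y \<le> norm (analysis f y)" for y
  proof (cases "y = 0")
    case False
    then have pos: "norm (analysis f y) > 0" using inj by auto
    have "(1 / norm (analysis f y)) *\<^sub>R y \<in> A" unfolding A_def using False by blast
    then have "norm ((1 / norm (analysis f y)) *\<^sub>R y) \<le> C'" using C C'(2) by fastforce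
    then show ?thesis using pos C'(1) by (simp add: field_simps)
  qed simp
  moreover have "1 / C' > 0" using C'(1) by simp
  ultimately show thesis using that by blast
qed

lemma J_frame_operator_eq:
  "J_frame f \<Longrightarrow> J_frame_operator f = (\<lambda>y. synthesis f (J_adjoint f f y))"
  by (auto simp: J_frame_operator_def krein_adjoint_synthesis J_frame_bessel)

lemma J_frame_operator_add:
  assumes "J_frame f"
  shows "J_frame_operator f (x + y) = J_frame_operator f x + J_frame_operator f y"
proof -
  have f: "bessel_family f" by (rule J_frame_bessel[OF assms])
  have "J_adjoint f f (x + y) = J_adjoint f f x + J_adjoint f f y"
    by (rule ell2_eqI) (simp add: coord_J_adjoint[OF f] plus_ell2.rep_eq form_add_left algebra_simps)
  then show ?thesis by (simp add: J_frame_operator_eq[OF assms] synthesis_add[OF f])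
qed

lemma J_frame_operator_scale:
  assumes "J_frame f"
  shows "J_frame_operator f (scaleC c x) = scaleC c (J_frame_operator f x)"
proof -
  have f: "bessel_family f" by (rule J_frame_bessel[OF assms])
  have "J_adjoint f f (scaleC c x) = ell2_scaleC c (J_adjoint f f x)"
    by (rule ell2_eqI) (simp add: coord_J_adjoint[OF f] ell2_scaleC.rep_eq form_scale_left)
  then show ?thesis by (simp add: J_frame_operator_eq[OF assms] synthesis_scale[OF f])
qed

text \<open>With \<open>a = analysis f (J y)\<close>, the J-frame operator sends \<open>y\<close> to \<open>u - v\<close> and the frame operator
  \<open>T T\<^sup>*\<close> sends \<open>J y\<close> to \<open>u + v\<close>, where \<open>u\<close> and \<open>v\<close> are the images of the two parts of \<open>a\<close>.\<close>

lemma J_frame_operator_split: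
  assumes "J_frame f"
  obtains u v where "u \<in> range (synthesis f \<circ> ell2_proj (index_pos f))"
    and "v \<in> range (synthesis f \<circ> ell2_proj (index_neg f))"
    and "J_frame_operator f y = u - v"
    and "synthesis f (analysis f (fundamental_symmetry y)) = u + v"
proof -
  have f: "bessel_family f" by (rule J_frame_bessel[OF assms])
  define a where "a = analysis f (fundamental_symmetry y)"
  define u where "u = synthesis f (ell2_proj (index_pos f) a)"
  define v where "v = synthesis f (ell2_proj (index_neg f) a)"
  have "J_frame_operator f y = u - v"
    by (simp add: J_frame_operator_eq[OF assms] J_adjoint_def a_def[symmetric] ell2_symmetry_def
        u_def v_def bounded_linear.linear[OF bounded_linear_synthesis[OF f], THEN linear_diff])
  moreover have "synthesis f a = u + v"
    unfolding u_def v_def synthesis_add[OF f, symmetric] by (simp only: ell2_proj_pos_plus_neg)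
  moreover have "u \<in> range (synthesis f \<circ> ell2_proj (index_pos f))"
    "v \<in> range (synthesis f \<circ> ell2_proj (index_neg f))"
    by (auto simp: u_def v_def)
  ultimately show thesis using that unfolding a_def by blast
qed

text \<open>Since the sum of the two ranges is direct, solving \<open>S y = u + v\<close> amounts to solving
  \<open>T T\<^sup>* (J y) = u - v\<close>, and \<open>T T\<^sup>*\<close> is coercive.\<close>

lemma J_frame_operator_bij:
  assumes J: "J_frame f"
  shows "bij (J_frame_operator f)"
    and "\<exists>K>0. \<forall>y. norm y \<le> K * norm (J_frame_operator f y)"
proof -
  let ?S = "J_frame_operator f"
  define Mp where "Mp = range (synthesis f \<circ> ell2_proj (index_pos f))"
  define Mn where "Mn = range (synthesis f \<circ> ell2_proj (index_neg f))"
  define B where "B h = synthesis f (analysis f h)" for h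
  have f: "bessel_family f" by (rule J_frame_bessel[OF J])
  have max: "maximal_uniformly_definite 1 Mp" "maximal_uniformly_definite (- 1) Mn"
    unfolding Mp_def Mn_def by (rule J_frame_maximal[OF J])+
  then have def: "uniformly_definite 1 Mp" "uniformly_definite (- 1) Mn"
    by (auto simp: maximal_uniformly_definite_def)
  then have sub: "subspace Mp" "subspace Mn" by (auto simp: uniformly_definite_def)
  obtain C where C: "C > 0"
    "\<And>u v. u \<in> Mp \<Longrightarrow> v \<in> Mn \<Longrightarrow> norm (u - v) \<le> C * norm (u + v)"
    using definite_pair_norm_le[OF def] by metis
  have split: "\<exists>u\<in>Mp. \<exists>v\<in>Mn. ?S y = u - v \<and> B (fundamental_symmetry y) = u + v" for y
    unfolding Mp_def Mn_def B_def using J_frame_operator_split[OF J, of y] by metis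
  obtain c where c: "c > 0" "\<And>y. c * norm y \<le> norm (analysis f y)"
    using synthesis_surj_imp_lower_frame_bound[OF f] J_frame_synthesis_surj[OF J] by metis
  have coercive: "c\<^sup>2 * (norm z)\<^sup>2 \<le> B z \<bullet> z" for z
  proof -
    have "(c * norm z)\<^sup>2 \<le> (norm (analysis f z))\<^sup>2"
      using c by (intro power_mono) auto
    then show ?thesis
      by (simp add: B_def inner_synthesis[OF f] power2_norm_eq_inner power_mult_distrib)
  qed
  have B: "bounded_linear B"
    unfolding B_def
    by (rule bounded_linear_compose[OF bounded_linear_synthesis[OF f] bounded_linear_analysis[OF f]])
  have B_lower: "c\<^sup>2 * norm z \<le> norm (B z)" for z
  proof (cases "z = 0")
    case False
    have "(c\<^sup>2 * norm z) * norm z \<le> B z \<bullet> z"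
      using coercive[of z] by (simp add: power2_eq_square mult.assoc)
    also have "\<dots> \<le> norm (B z) * norm z" by (rule norm_cauchy_schwarz)
    finally show ?thesis using False by simp
  qed simp
  have lower: "norm y \<le> C / c\<^sup>2 * norm (?S y)" for y
  proof -
    obtain u v where uv: "u \<in> Mp" "v \<in> Mn" "?S y = u - v" "B (fundamental_symmetry y) = u + v"
      using split by blast
    have "- v \<in> Mn" using subspace_neg[OF sub(2) uv(2)] .
    from C(2)[OF uv(1) this] have "norm (u + v) \<le> C * norm (u - v)" by simp
    then have "c\<^sup>2 * norm y \<le> C * norm (?S y)"
      using B_lower[of "fundamental_symmetry y"] uv(3,4) by simp
    then show ?thesis using c(1) by (simp add: field_simps)
  qed
  moreover have "C / c\<^sup>2 > 0" using C(1) c(1) by simp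
  ultimately show "\<exists>K>0. \<forall>y. norm y \<le> K * norm (?S y)" by blast
  have diff: "?S (x - y) = ?S x - ?S y" for x y
    using J_frame_operator_add[OF J, of "x - y" y] by (simp add: eq_diff_eq)
  have "inj ?S"
  proof (rule injI)
    fix x y assume "?S x = ?S y"
    then have "?S (x - y) = 0" by (simp add: diff)
    with lower[of "x - y"] show "x = y" by simp
  qed
  moreover have "surj ?S"
    unfolding surj_def
  proof
    fix h
    obtain u v where uv: "u \<in> Mp" "v \<in> Mn" "h = u + v"
      using maximal_pair_sum_UNIV[OF max] by metis
    have "surj B"
      by (rule coercive_surj[OF krein_space_complete B _ coercive]) (use c(1) in simp)
    then obtain z where z: "u - v = B z" by (rule surjE)
    define y where "y = fundamental_symmetry z"
    obtain u' v' where uv': "u' \<in> Mp" "v' \<in> Mn" "?S y = u' - v'" "B z = u' + v'"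
      using split[of y] by (auto simp: y_def)
    have in_M: "u' - u \<in> Mp" "v' + v \<in> Mn"
      using subspace_diff[OF sub(1)] subspace_add[OF sub(2)] uv uv' by auto
    have "(u' - u) + (v' + v) = 0" using z uv'(4) by (simp add: algebra_simps)
    with C(2)[OF in_M] have "(u' - u) - (v' + v) = 0" by simp
    then have "h = ?S y" by (simp add: uv(3) uv'(3) algebra_simps)
    then show "\<exists>y. h = ?S y" by blast
  qed
  ultimately show "bij ?S" by (rule bijI)
qed

section \<open>Dual families\<close>

text \<open>Subtracting the vector of \<open>R(T\<^sup>+)\<close> with the same image under \<open>T\<close> turns an
  element of the orthogonal companion into a vector of \<open>N(T)\<close> orthogonal both to \<open>N(T)\<close> and to
  \<open>R(T\<^sup>+)\<close>.  These two span \<open>\<ell>\<^sub>2\<close>, so the difference is zero.\<close>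

lemma orth_companion_null_space_synthesis:
  assumes J: "J_frame f"
  shows "orth_companion (ell2_form f) (null_space (synthesis f)) = range (J_adjoint f f)"
proof -
  let ?S = "J_frame_operator f" and ?T = "synthesis f" and ?A = "J_adjoint f f"
  have f: "bessel_family f" by (rule J_frame_bessel[OF J])
  have lin: "linear ?T" using bounded_linear_synthesis[OF f] by (rule bounded_linear.linear)
  have T_A: "?T (?A y) = ?S y" for y by (simp add: J_frame_operator_eq[OF J])
  have S_inv: "?S (inv ?S h) = h" for h
    using J_frame_operator_bij(1)[OF J] by (simp add: bij_is_surj surj_f_inv_f)
  define Q where "Q x = ?A (inv ?S (?T x))" for x
  have T_Q: "?T (x - Q x) = 0" for x by (simp add: linear_diff[OF lin] Q_def T_A S_inv)
  show ?thesis
  proof (intro equalityI subsetI)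
    fix x assume "x \<in> range ?A"
    then obtain y where x: "x = ?A y" by blast
    show "x \<in> orth_companion (ell2_form f) (null_space ?T)"
      unfolding orth_companion_def
    proof (intro CollectI ballI)
      fix n assume "n \<in> null_space ?T"
      then have "ell2_form f n x = 0"
        by (simp add: null_space_def x form_synthesis[OF f, symmetric])
      then show "ell2_form f x n = 0" using ell2_form_hermitian[of f x n] by simp
    qed
  next
    fix x assume x: "x \<in> orth_companion (ell2_form f) (null_space ?T)"
    have "Re (ell2_form f y x) = Re (ell2_form f y (Q x))" for y
    proof -
      have Re_diff: "Re (ell2_form f (a - b) z) = Re (ell2_form f a z) - Re (ell2_form f b z)" for a b z
        by (simp add: Re_ell2_form inner_diff_left)
      have Re_comm: "Re (ell2_form f a b) = Re (ell2_form f b a)" for a b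
        by (subst ell2_form_hermitian) simp
      have "ell2_form f x (y - Q y) = 0"
        using x T_Q[of y] by (simp add: orth_companion_def null_space_def)
      then have "Re (ell2_form f (y - Q y) x) = 0" by (simp add: Re_comm[of _ x])
      moreover have "ell2_form f (y - Q y) (Q x) = 0"
        unfolding Q_def[of x] form_synthesis[OF f, symmetric] T_Q by simp
      moreover have "ell2_form f (x - Q x) (Q y) = 0"
        unfolding Q_def[of y] form_synthesis[OF f, symmetric] T_Q by simp
      then have "Re (ell2_form f (Q y) x) = Re (ell2_form f (Q y) (Q x))"
        using Re_diff[of x "Q x" "Q y"] by (simp add: Re_comm[of "Q y"])
      ultimately show ?thesis
        using Re_diff[of y "Q y" x] Re_diff[of y "Q y" "Q x"] by simp
    qed
    then have "x = Q x" by (rule ell2_form_nondegenerate)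
    then show "x \<in> range ?A" unfolding Q_def by blast
  qed
qed

text \<open>The operator \<open>S\<^sup>-\<^sup>1 T\<close> is itself a left inverse of \<open>T\<^sup>+\<close>, so \<open>V = synthesis g\<close> is another one if
  and only if \<open>V - S\<^sup>-\<^sup>1 T\<close> kills the range of \<open>T\<^sup>+\<close>.\<close>

lemma dual_family_iff_perturbation:
  assumes J: "J_frame f" and g: "bessel_family g"
    and signs: "\<forall>i. form_sgn (f i) = form_sgn (g i)"
  shows "dual_family f g \<longleftrightarrow>
    (\<exists>W. bounded_clinear ell2_scaleC scaleC W \<and>
         orth_companion (ell2_form f) (null_space (synthesis f)) \<subseteq> null_space W \<and>
         synthesis g = (\<lambda>x. inv (J_frame_operator f) (synthesis f x) + W x))"
proof -
  let ?S = "J_frame_operator f" and ?T = "synthesis f" and ?V = "synthesis g"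
  let ?A = "J_adjoint f f"
  have f: "bessel_family f" by (rule J_frame_bessel[OF J])
  have T_A: "?T (?A y) = ?S y" for y by (simp add: J_frame_operator_eq[OF J])
  have bij: "bij ?S" by (rule J_frame_operator_bij(1)[OF J])
  have inv_S: "inv ?S (?S y) = y" for y using bij by (simp add: bij_is_inj)
  have S_inv: "?S (inv ?S h) = h" for h using bij by (simp add: bij_is_surj surj_f_inv_f)
  show ?thesis
    unfolding dual_family_iff[OF f g signs] orth_companion_null_space_synthesis[OF J]
  proof
    assume dual: "\<forall>x. ?V (?A x) = x"
    define W where "W x = ?V x - inv ?S (?T x)" for x
    have "bounded_clinear ell2_scaleC scaleC W"
    proof -
      obtain K where K: "K > 0" "\<And>y. norm y \<le> K * norm (?S y)"
        using J_frame_operator_bij(2)[OF J] by blast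
      obtain KT where KT: "\<And>x. norm (?T x) \<le> norm x * KT"
        using synthesis_bounded[OF f] by metis
      obtain KV where KV: "\<And>x. norm (?V x) \<le> norm x * KV"
        using synthesis_bounded[OF g] by metis
      have inv_add: "inv ?S (a + b) = inv ?S a + inv ?S b" for a b
        using inv_S[of "inv ?S a + inv ?S b"] by (simp add: J_frame_operator_add[OF J] S_inv)
      have inv_scale: "inv ?S (scaleC c a) = scaleC c (inv ?S a)" for c a
        using inv_S[of "scaleC c (inv ?S a)"] by (simp add: J_frame_operator_scale[OF J] S_inv)
      show ?thesis
      proof (rule bounded_clinearI[of _ "KV + K * KT"])
        fix x
        have "norm (inv ?S (?T x)) \<le> K * norm (?T x)" using K(2)[of "inv ?S (?T x)"] by (simp add: S_inv)
        also have "\<dots> \<le> K * (norm x * KT)" using K(1) KT by (intro mult_left_mono) auto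
        finally have "norm (W x) \<le> norm x * KV + K * (norm x * KT)"
          unfolding W_def using norm_triangle_ineq4[of "?V x" "inv ?S (?T x)"] KV[of x] by linarith
        then show "norm (W x) \<le> norm x * (KV + K * KT)" by (simp add: algebra_simps)
      qed (simp_all add: W_def inv_add inv_scale synthesis_add[OF f] synthesis_add[OF g]
          synthesis_scale[OF f] synthesis_scale[OF g] scale_right_diff_distrib)
    qed
    moreover have "range ?A \<subseteq> null_space W"
      using dual by (auto simp: null_space_def W_def T_A inv_S)
    moreover have "?V = (\<lambda>x. inv ?S (?T x) + W x)" by (simp add: W_def)
    ultimately show "\<exists>W. bounded_clinear ell2_scaleC scaleC W \<and> range ?A \<subseteq> null_space W \<and>
        ?V = (\<lambda>x. inv ?S (?T x) + W x)" by blast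
  next
    assume "\<exists>W. bounded_clinear ell2_scaleC scaleC W \<and> range ?A \<subseteq> null_space W \<and>
        ?V = (\<lambda>x. inv ?S (?T x) + W x)"
    then obtain W where W: "range ?A \<subseteq> null_space W" "?V = (\<lambda>x. inv ?S (?T x) + W x)" by blast
    have "W (?A x) = 0" for x using W(1) by (auto simp: null_space_def)
    then show "\<forall>x. ?V (?A x) = x" by (simp add: W(2) T_A inv_S)
  qed
qed

end

theorem proposition4p5:
  fixes scaleC :: "complex \<Rightarrow> 'h::real_inner \<Rightarrow> 'h"
    and form :: "'h \<Rightarrow> 'h \<Rightarrow> complex"
    and Hp Hm :: "'h set"
    and f g :: "'i \<Rightarrow> 'h"
    and T V :: "'i ell2 \<Rightarrow> 'h"
    and S :: "'h \<Rightarrow> 'h"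
  assumes "krein_space scaleC form Hp Hm"
    and "krein_space.J_frame scaleC form Hp Hm f"
    and "T = krein_space.synthesis scaleC f"
    and "S = krein_space.J_frame_operator scaleC form f"
    and "krein_space.bessel_family form Hp Hm g"
    and same_signs: "\<forall>i. krein_space.form_sgn form (f i) = krein_space.form_sgn form (g i)"
    and "V = krein_space.synthesis scaleC g"
  shows "krein_space.dual_family scaleC form Hp Hm f g \<longleftrightarrow>
    (\<exists>W. bounded_clinear ell2_scaleC scaleC W \<and>
         orth_companion (krein_space.ell2_form form f) (null_space T) \<subseteq> null_space W \<and>
         V = (\<lambda>x. inv S (T x) + W x))"
proof -
  interpret krein_space scaleC form Hp Hm by fact
  show ?thesis
    unfolding assms(3,4,7) by (rule dual_family_iff_perturbation[OF assms(2,5) same_signs])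
qed

end
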